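(* Let $d \geq 2$ be an integer. Let $\xi_1, \xi_2, \ldots$ be independent random vectors, each uniformly distributed on the Euclidean unit sphere $S^{d-1} \subset \mathbb{R}^d$, and let $G_1, G_2, \ldots$ be independent standard Gaussian random vectors in $\mathbb{R}^d$ (mean zero, identity covariance matrix). Then for every $m \geq 1$, all real numbers $a_1, \ldots, a_m$ and every $t > 0$, \[ \mathbb{P}\left(\left\|\sum_{i=1}^m a_i \xi_i\right\| > t\right) \leq 397 \cdot \mathbb{P}\left(\left\|\sum_{i=1}^m a_i \frac{G_i}{\sqrt{d}}\right\| > t\right). \]
   Context: $\|\cdot\|$ denotes the standard Euclidean norm on $\mathbb{R}^d$. *)

theory Defs
  imports "HOL-Probability.Probability"
begin

text \<open>Normalized (uniform) surface measure on the unit sphere of a Euclidean space,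
  realized as the cone measure: the mass of a Borel set A of the sphere is the
  Lebesgue measure of the cone {t x | x in A, 0 < t <= 1} divided by the volume
  of the unit ball.\<close>
definition cone_of :: "'a::euclidean_space set \<Rightarrow> 'a set" where
  "cone_of A = {t *\<^sub>R x | t x. x \<in> A \<inter> sphere 0 1 \<and> 0 < t \<and> t \<le> 1}"

definition uniform_on_sphere :: "'b measure \<Rightarrow> ('b \<Rightarrow> 'a::euclidean_space) \<Rightarrow> bool" where
  "uniform_on_sphere M X \<longleftrightarrow> X \<in> borel_measurable M \<and>
     (\<forall>A \<in> sets borel. measure M (X -` A \<inter> space M)
        = measure lborel (cone_of A) / measure lborel (ball (0::'a) 1))"

definition std_gaussian_vector :: "'b measure \<Rightarrow> ('b \<Rightarrow> 'a::euclidean_space) \<Rightarrow> bool" where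
  "std_gaussian_vector M X \<longleftrightarrow>
     distributed M lborel X
       (\<lambda>x. ennreal ((2 * pi) powr (- real DIM('a) / 2) * exp (- (norm x)\<^sup>2 / 2)))"

end

theory Submission
  imports Defs
begin

text \<open>For every real \<open>s\<close> put \<open>f x = max 0 (\<bar>x\<bar>\<^sup>2 - s) ^ 3\<close>. On each line this is, up to translation, a
  function \<open>g y = max 0 (y\<^sup>2 + q) ^ 3\<close> with convex second derivative, so that for every unit vector \<open>e\<close>
  the function \<open>f (x + r e) + f (x - r e)\<close> is convex in \<open>r\<^sup>2\<close>. A standard Gaussian vector is the
  product of a uniform direction and an independent radius with second moment \<open>d\<close>, so Jensen's
  inequality gives \<open>E f (x + a \<xi>) \<le> E f (x + a G / sqrt d)\<close>, and replacing the summands one at a time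
  gives \<open>E f (S) \<le> E f (T)\<close> for the two sums. Now \<open>T\<close> is Gaussian and, as \<open>d \<ge> 2\<close>, the density of
  \<open>\<bar>T\<bar>\<^sup>2\<close> is log-concave, whence \<open>P (\<bar>T\<bar>\<^sup>2 > z) \<le> P (\<bar>T\<bar>\<^sup>2 > t\<^sup>2) exp (- l (z - t\<^sup>2))\<close> for all \<open>z\<close>, where
  \<open>l\<close> is the hazard rate at \<open>t\<^sup>2\<close>. Markov's inequality for \<open>f\<close> with \<open>s = t\<^sup>2 - 3 / l\<close> then yields the
  tail comparison, even with the constant \<open>6 e\<^sup>3 / 27 < 6\<close>.\<close>

subsection \<open>Convexity of symmetrised cubes in the squared radius\<close>

text \<open>An exponent of at least 2, hence \<open>Suc (Suc n)\<close>, removes the kink at 0: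
  there the difference quotient is bounded by \<open>max 0 h ^ Suc n\<close>, which tends to
  0.\<close>

lemma has_real_derivative_max_0_power:
  "((\<lambda>z. max 0 z ^ Suc (Suc n)) has_real_derivative real (Suc (Suc n)) * max 0 z ^ Suc n) (at z)"
proof -
  consider "z > 0" | "z < 0" | "z = 0" by linarith
  then show ?thesis
  proof cases
    case 1
    have "((\<lambda>z::real. z ^ Suc (Suc n)) has_real_derivative real (Suc (Suc n)) * z ^ Suc n) (at z)"
      using DERIV_pow[of "Suc (Suc n)" z] by simp
    moreover have "eventually (\<lambda>x. x ^ Suc (Suc n) = max 0 x ^ Suc (Suc n)) (nhds z)"
      using eventually_nhds_in_open[of "{0<..}" z] 1 by (auto elim!: eventually_mono simp: max_def)
    ultimately show ?thesis using 1 by (subst (asm) DERIV_cong_ev[OF refl _ refl]) (auto simp: max_def)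
  next
    case 2
    have "((\<lambda>z::real. 0) has_real_derivative 0) (at z)"
      by auto
    moreover have "eventually (\<lambda>x. 0 = max 0 x ^ Suc (Suc n)) (nhds z)"
      using eventually_nhds_in_open[of "{..<0}" z] 2 by (auto elim!: eventually_mono simp: max_def)
    ultimately show ?thesis using 2 by (subst (asm) DERIV_cong_ev[OF refl _ refl]) (auto simp: max_def)
  next
    case 3
    have "((\<lambda>h::real. max 0 h ^ Suc (Suc n) / h) \<longlongrightarrow> 0) (at 0)"
    proof (rule tendsto_0_le[where K = 1])
      show "((\<lambda>h::real. max 0 h ^ Suc n) \<longlongrightarrow> 0) (at 0)"
        by (auto intro!: tendsto_eq_intros)
      show "\<forall>\<^sub>F x in at 0. norm (max 0 x ^ Suc (Suc n) / x) \<le> norm (max 0 x ^ Suc n :: real) * 1"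
        by (auto simp: max_def eventually_at_filter intro!: always_eventually)
    qed
    then show ?thesis using 3 by (simp add: DERIV_def)
  qed
qed

lemma has_real_derivative_max_0_power_chain:
  assumes "(f has_real_derivative f') (at x)"
  shows "((\<lambda>x. max 0 (f x) ^ Suc (Suc n)) has_real_derivative
           real (Suc (Suc n)) * max 0 (f x) ^ Suc n * f') (at x)"
  using DERIV_chain2[OF has_real_derivative_max_0_power[of n "f x"] assms] by simp

text \<open>Both \<open>c + r\<close> and \<open>c - r\<close> are convex combinations of
  \<open>c - s\<close> and \<open>c + s\<close>, with the weights \<open>t\<close> and
  \<open>1 - t\<close> interchanged, so the weights cancel when the two convexity inequalities are
  added.\<close>

lemma convex_on_symmetric_sum_mono:
  fixes g :: "real \<Rightarrow> real"
  assumes "convex_on UNIV g" "0 \<le> r" "r \<le> s"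
  shows "g (c + r) + g (c - r) \<le> g (c + s) + g (c - s)"
proof (cases "s = 0")
  case False
  define t where "t = (1 + r / s) / 2"
  have s: "s > 0" using False assms by simp
  have t: "0 \<le> t" "t \<le> 1" using assms s by (auto simp: t_def field_simps)
  have e: "(1 - t) * (c - s) + t * (c + s) = c + r" "(1 - t) * (c + s) + t * (c - s) = c - r"
    using s by (auto simp: t_def field_simps)
  show ?thesis
    using convex_onD[OF assms(1) t, of "c - s" "c + s"] convex_onD[OF assms(1) t, of "c + s" "c - s"]
    unfolding real_scaleR_def e by (simp add: algebra_simps)
qed (use assms in simp)

text \<open>The symmetrised derivative \<open>r \<mapsto> g1 (c + r) - g1 (c - r)\<close> is convex and vanishes at 0, so its
  quotient by \<open>r\<close> increases; hence \<open>g (c + r) + g (c - r)\<close> is convex as a function of \<open>r\<^sup>2\<close>.\<close>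
lemma symmetric_sum_ge_tangent:
  fixes g g1 g2 :: "real \<Rightarrow> real"
  assumes g: "\<And>y. (g has_real_derivative g1 y) (at y)"
    and g1: "\<And>y. (g1 has_real_derivative g2 y) (at y)"
    and g2: "convex_on UNIV g2"
    and r: "r0 > 0" "r \<ge> 0"
  shows "g (c + r) + g (c - r) \<ge> g (c + r0) + g (c - r0)
           + (g1 (c + r0) - g1 (c - r0)) / (2 * r0) * (r\<^sup>2 - r0\<^sup>2)"
proof -
  define F1 where "F1 = (\<lambda>r. g1 (c + r) - g1 (c - r))"
  define \<kappa> where "\<kappa> = F1 r0 / (2 * r0)"
  \<comment> \<open>\<open>D\<close> is the symmetrised sum minus a linear function of the squared
    radius. Since \<open>F1 r / r\<close> increases and equals \<open>2 * \<kappa>\<close> at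
    \<open>r0\<close>, \<open>D\<close> decreases up to \<open>r0\<close> and increases afterwards,
    so \<open>r0\<close> is its minimum.\<close>
  define D where "D = (\<lambda>r. g (c + r) + g (c - r) - \<kappa> * r\<^sup>2)"
  have dD: "(D has_real_derivative F1 r - 2 * \<kappa> * r) (at r)" for r
    unfolding D_def F1_def
    by (auto intro!: derivative_eq_intros DERIV_chain2[OF g])
  have dF: "(F1 has_real_derivative g2 (c + r) + g2 (c - r)) (at r)" for r
    unfolding F1_def by (auto intro!: derivative_eq_intros DERIV_chain2[OF g1])
  have cF: "convex_on {0..} F1"
    by (rule convex_on_realI[OF _ dF])
       (auto intro!: convex_connected convex_on_symmetric_sum_mono[OF g2])
  have F0: "F1 0 = 0" by (simp add: F1_def)
  \<comment> \<open>Monotonicity of \<open>F1 x / x\<close>, cleared of denominators so that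
    \<open>x = 0\<close> is covered; it is convexity between 0 and \<open>y\<close> together with
    \<open>F1 0 = 0\<close>.\<close>
  have up: "F1 x * y \<le> F1 y * x" if "0 \<le> x" "x \<le> y" "0 < y" for x y
    using convex_onD[OF cF, of "x / y" 0 y] that F0 by (auto simp: field_simps)
  have "D r0 \<le> D r"
  proof (cases "r0 \<le> r")
    case True
    have "F1 x - 2 * \<kappa> * x \<ge> 0" if "r0 \<le> x" for x
      using up[of r0 x] that r by (auto simp: \<kappa>_def field_simps)
    then show ?thesis
      by (intro DERIV_nonneg_imp_nondecreasing[OF True]) (use dD in blast)
  next
    case False
    have "F1 x - 2 * \<kappa> * x \<le> 0" if "0 \<le> x" "x \<le> r0" for x
      using up[of x r0] that r by (auto simp: \<kappa>_def field_simps)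
    then show ?thesis
      using False r by (intro DERIV_nonpos_imp_nonincreasing[of r r0]) (use dD in \<open>auto intro!: exI\<close>)
  qed
  then have "g (c + r) + g (c - r) \<ge> g (c + r0) + g (c - r0) + \<kappa> * (r\<^sup>2 - r0\<^sup>2)"
    by (simp add: D_def right_diff_distrib)
  then show ?thesis by (simp add: \<kappa>_def F1_def)
qed

lemma convex_on_power2_nonneg:
  fixes f :: "real \<Rightarrow> real"
  assumes "convex_on UNIV f" "\<And>x. f x \<ge> 0"
  shows "convex_on UNIV (\<lambda>x. (f x)\<^sup>2)"
proof (rule convex_onI)
  fix t x y :: real assume t: "0 < t" "t < 1"
  have "(f ((1 - t) *\<^sub>R x + t *\<^sub>R y))\<^sup>2 \<le> ((1 - t) * f x + t * f y)\<^sup>2"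
    using convex_onD[OF assms(1), of t x y] t assms(2) by (intro power_mono) auto
  also have "\<dots> \<le> (1 - t) * (f x)\<^sup>2 + t * (f y)\<^sup>2"
    using convex_onD[OF convex_power2, of t "f x" "f y"] t by auto
  finally show "(f ((1 - t) *\<^sub>R x + t *\<^sub>R y))\<^sup>2 \<le> (1 - t) * (f x)\<^sup>2 + t * (f y)\<^sup>2" .
qed simp

text \<open>This is the second derivative of \<open>max 0 (y\<^sup>2 + q) ^ 3\<close>, with
  \<open>y\<^sup>2\<close> rewritten as \<open>(y\<^sup>2 + q) - q\<close>. For
  \<open>q \<le> 0\<close> both coefficients are nonnegative and
  \<open>max 0 (y\<^sup>2 + q)\<close> is convex; for \<open>q > 0\<close> the maximum is inactive
  and an even polynomial with nonnegative coefficients remains. For negative \<open>q\<close> a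
  square in place of the cube would have a second derivative that jumps at
  \<open>y\<^sup>2 = - q\<close>.\<close>

lemma convex_on_second_derivative_cube:
  fixes q :: real
  shows "convex_on UNIV (\<lambda>y. 30 * max 0 (y\<^sup>2 + q) ^ 2 - 24 * q * max 0 (y\<^sup>2 + q))"
proof (cases "q \<le> 0")
  case True
  have c: "convex_on UNIV (\<lambda>y. max 0 (y\<^sup>2 + q))"
  proof (rule convex_onI)
    fix t x y :: real assume t: "0 < t" "t < 1"
    have "((1 - t) * x + t * y)\<^sup>2 + q \<le> (1 - t) * (x\<^sup>2 + q) + t * (y\<^sup>2 + q)"
      using convex_onD[OF convex_power2, of t x y] t by (simp add: algebra_simps)
    also have "\<dots> \<le> (1 - t) * max 0 (x\<^sup>2 + q) + t * max 0 (y\<^sup>2 + q)"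
      using t by (intro add_mono mult_left_mono) auto
    finally show "max 0 (((1 - t) *\<^sub>R x + t *\<^sub>R y)\<^sup>2 + q)
        \<le> (1 - t) * max 0 (x\<^sup>2 + q) + t * max 0 (y\<^sup>2 + q)"
      using t by auto
  qed simp
  have "convex_on UNIV (\<lambda>y. 30 * max 0 (y\<^sup>2 + q) ^ 2 + (- 24 * q) * max 0 (y\<^sup>2 + q))"
    using True
    by (intro convex_on_add convex_on_cmul convex_on_power2_nonneg c) auto
  then show ?thesis by simp
next
  case False
  have "convex_on UNIV (\<lambda>y::real. 30 * (y\<^sup>2)\<^sup>2 + 36 * q * y\<^sup>2 + 6 * q\<^sup>2)"
    using False
    by (intro convex_on_add convex_on_cmul convex_on_power2_nonneg convex_power2) (auto simp: convex_on_def simp flip: distrib_right)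
  moreover have "(\<lambda>y. 30 * max 0 (y\<^sup>2 + q) ^ 2 - 24 * q * max 0 (y\<^sup>2 + q)) =
    (\<lambda>y::real. 30 * (y\<^sup>2)\<^sup>2 + 36 * q * y\<^sup>2 + 6 * q\<^sup>2)"
    using False by (auto simp: fun_eq_iff max_def power2_eq_square algebra_simps)
  ultimately show ?thesis by simp
qed

lemma cube_symmetric_sum_ge_tangent:
  fixes c q r r0 :: real
  defines "g \<equiv> \<lambda>y. max 0 (y\<^sup>2 + q) ^ 3" and "g1 \<equiv> \<lambda>y. 6 * y * max 0 (y\<^sup>2 + q) ^ 2"
  assumes "r0 > 0" "r \<ge> 0"
  shows "g (c + r) + g (c - r) \<ge> g (c + r0) + g (c - r0)
           + (g1 (c + r0) - g1 (c - r0)) / (2 * r0) * (r\<^sup>2 - r0\<^sup>2)"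
proof (rule symmetric_sum_ge_tangent[OF _ _ convex_on_second_derivative_cube[of q]])
  fix y :: real
  have "((\<lambda>y. y\<^sup>2 + q) has_real_derivative 2 * y) (at y)"
    by (auto intro!: derivative_eq_intros)
  note d = has_real_derivative_max_0_power_chain[OF this]
  show "(g has_real_derivative g1 y) (at y)"
    using d[of 1] by (simp add: g_def g1_def numeral_eq_Suc mult_ac)
  have "((\<lambda>y. max 0 (y\<^sup>2 + q) ^ 2) has_real_derivative 4 * y * max 0 (y\<^sup>2 + q)) (at y)"
    using d[of 0] by (simp add: numeral_2_eq_2 mult_ac)
  note * = DERIV_mult[OF DERIV_cmult_Id[of 6 y] this]
  show "(g1 has_real_derivative 30 * max 0 (y\<^sup>2 + q) ^ 2 - 24 * q * max 0 (y\<^sup>2 + q)) (at y)"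
    unfolding g1_def by (rule DERIV_cong[OF *]) (auto simp: max_def power2_eq_square algebra_simps)
qed fact+

subsection \<open>Polar coordinates\<close>

text \<open>In terms of \<open>sgn\<close> the cone is a preimage, which yields its measurability
  and its behaviour under scaling.\<close>

lemma cone_of_eq: "cone_of A = {x::'a::euclidean_space. x \<noteq> 0 \<and> norm x \<le> 1 \<and> sgn x \<in> A}"
proof (intro set_eqI iffI)
  fix x :: 'a assume "x \<in> {x. x \<noteq> 0 \<and> norm x \<le> 1 \<and> sgn x \<in> A}"
  then have "x \<noteq> 0" "norm x \<le> 1" "sgn x \<in> A" by auto
  moreover have "x = norm x *\<^sub>R sgn x" using \<open>x \<noteq> 0\<close> by (simp add: sgn_div_norm)
  ultimately show "x \<in> cone_of A"
    unfolding cone_of_def by (intro CollectI exI[of _ "norm x"] exI[of _ "sgn x"]) (auto simp: norm_sgn)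
next
  fix x :: 'a assume "x \<in> cone_of A"
  then obtain t y where "x = t *\<^sub>R y" "y \<in> A" "norm y = 1" "0 < t" "t \<le> 1"
    unfolding cone_of_def by auto
  then show "x \<in> {x. x \<noteq> 0 \<and> norm x \<le> 1 \<and> sgn x \<in> A}"
    by (auto simp: sgn_div_norm)
qed

lemma borel_measurable_sgn_euclidean [measurable]:
  "(sgn :: 'a::euclidean_space \<Rightarrow> 'a) \<in> borel_measurable borel"
  unfolding sgn_div_norm by measurable

lemma cone_of_measurable [measurable]:
  assumes [measurable]: "A \<in> sets borel"
  shows "cone_of A \<in> sets (borel :: 'a::euclidean_space measure)"
  unfolding cone_of_eq by measurable

lemma nn_integral_lborel_scale:
  fixes f :: "'a::euclidean_space \<Rightarrow> ennreal"
  assumes [measurable]: "f \<in> borel_measurable borel" and c: "c \<noteq> 0"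
  shows "(\<integral>\<^sup>+x. f x \<partial>lborel) = ennreal (\<bar>c\<bar> ^ DIM('a)) * (\<integral>\<^sup>+x. f (c *\<^sub>R x) \<partial>lborel)"
  by (subst lborel_affine[OF c, of 0])
     (simp add: nn_integral_density nn_integral_distr nn_integral_cmult)

lemma nn_integral_lborel_translate:
  fixes f :: "'a::euclidean_space \<Rightarrow> ennreal"
  assumes [measurable]: "f \<in> borel_measurable borel"
  shows "(\<integral>\<^sup>+x. f (c + x) \<partial>lborel) = (\<integral>\<^sup>+x. f x \<partial>lborel)"
  by (subst (2) lborel_distr_plus[of c, symmetric]) (simp add: nn_integral_distr)

lemma emeasure_lborel_sector:
  fixes A :: "'a::euclidean_space set"
  assumes [measurable]: "A \<in> sets borel" and r: "r > 0"
  shows "emeasure lborel {x. norm x \<le> r \<and> sgn x \<in> A} = ennreal (r ^ DIM('a)) * emeasure lborel (cone_of A)"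
proof -
  have "emeasure lborel {x. norm x \<le> r \<and> sgn x \<in> A}
      = (\<integral>\<^sup>+x. indicator {x. norm x \<le> r \<and> sgn x \<in> A} x \<partial>(lborel::'a measure))"
    by simp
  also have "\<dots> = ennreal (r ^ DIM('a)) *
      (\<integral>\<^sup>+x. indicator {x. norm x \<le> r \<and> sgn x \<in> A} (r *\<^sub>R x) \<partial>(lborel::'a measure))"
    using r by (subst nn_integral_lborel_scale[of _ r]) auto
  \<comment> \<open>The two sets can differ only at the origin, which \<open>cone_of\<close> omits,
    whereas \<open>sgn 0 = 0\<close> may lie in \<open>A\<close>.\<close>
  also have "(\<integral>\<^sup>+x. indicator {x. norm x \<le> r \<and> sgn x \<in> A} (r *\<^sub>R x) \<partial>(lborel::'a measure))
      = (\<integral>\<^sup>+x. indicator (cone_of A) x \<partial>lborel)"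
    using r AE_lborel_singleton[of "0::'a"]
    by (intro nn_integral_cong_AE) (auto elim!: eventually_mono simp: cone_of_eq indicator_def sgn_scaleR)
  also have "\<dots> = emeasure lborel (cone_of A)" by simp
  finally show ?thesis .
qed

lemma emeasure_cone_of_finite: "emeasure lborel (cone_of (A :: 'a::euclidean_space set)) < \<infinity>"
proof -
  have "emeasure lborel (cone_of A) \<le> emeasure lborel (cball (0::'a) 1)"
    by (intro emeasure_mono) (auto simp: cone_of_eq)
  also have "\<dots> < \<infinity>" by (rule emeasure_lborel_cball_finite)
  finally show ?thesis .
qed

text \<open>The radial variable is the squared norm \<open>w\<close>. By
  \<open>emeasure_lborel_sector\<close> the part of the sector with squared norm at most
  \<open>b\<close> has the volume of the cone times \<open>b powr k\<close>, where \<open>k\<close>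
  is half the dimension, and the radial weight is the derivative of this power. Both sides are
  integrals against measures on the line that agree on every half-line \<open>{..b}\<close>.\<close>

lemma nn_integral_polar:
  fixes A :: "'a::euclidean_space set" and F :: "real \<Rightarrow> ennreal"
  assumes A[measurable]: "A \<in> sets borel" and F[measurable]: "F \<in> borel_measurable borel"
  shows "(\<integral>\<^sup>+x. indicator A (sgn x) * F ((norm x)\<^sup>2) \<partial>(lborel :: 'a measure))
    = emeasure lborel (cone_of A) *
      (\<integral>\<^sup>+w. ennreal (DIM('a) / 2 * w powr (DIM('a) / 2 - 1)) * indicator {0<..} w * F w \<partial>lborel)"
proof -
  define k where "k = real DIM('a) / 2"
  have k: "k > 0" by (simp add: k_def)
  define \<nu> where "\<nu> = distr (density lborel (\<lambda>x::'a. indicator A (sgn x))) borel (\<lambda>x. (norm x)\<^sup>2)"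
  define \<rho> where "\<rho> = density lborel (\<lambda>w. emeasure lborel (cone_of A) * (ennreal (k * w powr (k - 1)) * indicator {0<..} w))"
  have I: "(\<integral>\<^sup>+w. ennreal (k * w powr (k - 1)) * indicator {0<..} w * indicator {..b} w \<partial>lborel) = ennreal (b powr k)"
    if "b > 0" for b
  proof -
    \<comment> \<open>Derivatives are taken only in the interior, since in dimension one the
      exponent \<open>k - 1\<close> is negative and the weight is unbounded at 0.\<close>
    have "((\<lambda>w. k * w powr (k - 1)) has_integral (b powr k - 0 powr k)) {0..b}"
      using that k by (intro fundamental_theorem_of_calculus_interior)
        (auto intro!: continuous_on_powr' continuous_on_id continuous_on_const derivative_eq_intros simp flip: has_real_derivative_iff_has_vector_derivative)
    then have "(\<integral>\<^sup>+w. ennreal (k * w powr (k - 1)) * indicator {0..b} w \<partial>lborel) = ennreal (b powr k)"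
      using k nn_integral_has_integral_lebesgue'[of "{0..b}" "\<lambda>w. k * w powr (k - 1)"] by simp
    also have "(\<integral>\<^sup>+w. ennreal (k * w powr (k - 1)) * indicator {0..b} w \<partial>lborel) =
       (\<integral>\<^sup>+w. ennreal (k * w powr (k - 1)) * indicator {0<..} w * indicator {..b} w \<partial>lborel)"
      by (intro nn_integral_cong) (auto simp: indicator_def)
    finally show ?thesis .
  qed
  have emeasure_nu: "emeasure \<nu> {..b} = (\<integral>\<^sup>+x. indicator A (sgn x) * indicator {..b} ((norm x)\<^sup>2) \<partial>(lborel::'a measure))" for b
    by (subst nn_integral_indicator[symmetric], simp add: \<nu>_def)
       (simp add: \<nu>_def nn_integral_distr nn_integral_density del: nn_integral_indicator)
  have eq: "emeasure \<nu> {..b} = emeasure \<rho> {..b}" for b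
  proof (cases "b > 0")
    case True
    have "emeasure \<nu> {..b} = (\<integral>\<^sup>+x. indicator {x. norm x \<le> sqrt b \<and> sgn x \<in> A} x \<partial>(lborel :: 'a measure))"
      unfolding emeasure_nu using True
      by (intro nn_integral_cong) (auto simp: indicator_def real_le_rsqrt sqrt_ge_absD)
    also have "\<dots> = emeasure lborel {x::'a. norm x \<le> sqrt b \<and> sgn x \<in> A}"
      by (rule nn_integral_indicator) simp
    also have "\<dots> = ennreal (sqrt b ^ DIM('a)) * emeasure lborel (cone_of A)"
      using True by (intro emeasure_lborel_sector) auto
    also have "sqrt b ^ DIM('a) = b powr k"
      using True by (simp add: k_def powr_half_sqrt[symmetric] powr_powr flip: powr_realpow)
    also have "ennreal (b powr k) * emeasure lborel (cone_of A) = emeasure \<rho> {..b}"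
      using True by (simp add: \<rho>_def emeasure_density mult.assoc nn_integral_cmult I[unfolded mult.assoc] mult.commute[of "ennreal (b powr k)"])
    finally show ?thesis .
  next
    case False
    \<comment> \<open>For \<open>b \<le> 0\<close> at most the origin contributes, a null
      set.\<close>
    have "emeasure \<nu> {..b} = (\<integral>\<^sup>+x. 0 \<partial>(lborel::'a measure))"
      unfolding emeasure_nu
      using AE_lborel_singleton[of "0::'a"] False
      by (intro nn_integral_cong_AE) (auto elim!: eventually_mono simp: indicator_def,
        metis norm_le_zero_iff order.trans power2_less_eq_zero_iff not_less zero_less_power2 order_less_le_trans norm_eq_zero)
    also have "\<dots> = emeasure \<rho> {..b}"
      using False by (auto simp: \<rho>_def emeasure_density nn_integral_0_iff_AE indicator_def)
    finally show ?thesis .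
  qed
  have "\<nu> = \<rho>"
  proof (rule measure_eqI_generator_eq[where E = "range (\<lambda>a. {..a})" and \<Omega> = UNIV and A = "\<lambda>n. {..real (Suc n)}"])
    show "Int_stable (range (\<lambda>a::real. {..a}))"
      by (auto simp: Int_stable_def Int_atMost)
    show "sets \<nu> = sigma_sets UNIV (range (\<lambda>a. {..a}))" "sets \<rho> = sigma_sets UNIV (range (\<lambda>a. {..a}))"
      by (auto simp: \<nu>_def \<rho>_def borel_eq_atMost)
    show "(\<Union>n. {..real (Suc n)}) = UNIV"
    proof (intro set_eqI iffI UNIV_I)
      fix x :: real
      have "x \<le> real (Suc (nat \<lceil>x\<rceil>))" using real_nat_ceiling_ge[of x] by simp
      then show "x \<in> (\<Union>n. {..real (Suc n)})" by blast
    qed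
    show "emeasure \<nu> {..real (Suc n)} \<noteq> \<infinity>" for n
      using emeasure_cone_of_finite[of A]
      by (simp add: eq \<rho>_def emeasure_density mult.assoc nn_integral_cmult I[unfolded mult.assoc] ennreal_mult_eq_top_iff)
  qed (use eq in auto)
  then have "(\<integral>\<^sup>+w. F w \<partial>\<nu>) = (\<integral>\<^sup>+w. F w \<partial>\<rho>)" by simp
  then show ?thesis
    by (simp add: \<nu>_def \<rho>_def nn_integral_distr nn_integral_density nn_integral_cmult k_def mult.assoc)
qed

subsection \<open>Gaussian measures\<close>

text \<open>The centred Gaussian with covariance \<open>v\<close> times the identity; with the
  variance as parameter, convolution adds parameters. At \<open>v = 0\<close> the density vanishes
  because \<open>0 powr y = 0\<close>, so \<open>gauss 0\<close> is the null measure and not a point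
  mass.\<close>

definition gauss_density :: "real \<Rightarrow> 'a::euclidean_space \<Rightarrow> real" where
  "gauss_density v x = (2 * pi * v) powr (- real DIM('a) / 2) * exp (- (norm x)\<^sup>2 / (2 * v))"

definition gauss :: "real \<Rightarrow> 'a::euclidean_space measure" where
  "gauss v = density lborel (\<lambda>x. ennreal (gauss_density v x))"

lemma gauss_density_measurable [measurable]: "gauss_density v \<in> borel_measurable borel"
  unfolding gauss_density_def[abs_def] by measurable

lemma gauss_density_nonneg [simp]: "gauss_density v x \<ge> 0"
  by (simp add: gauss_density_def)

lemma sets_gauss [measurable_cong, simp]: "sets (gauss v) = sets borel"
  by (simp add: gauss_def)

lemma space_gauss [simp]: "space (gauss v) = UNIV"
  by (simp add: gauss_def)

lemma nn_integral_gauss: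
  "f \<in> borel_measurable borel \<Longrightarrow>
   (\<integral>\<^sup>+x. f x \<partial>gauss v) = (\<integral>\<^sup>+x. ennreal (gauss_density v x) * f x \<partial>lborel)"
  by (simp add: gauss_def nn_integral_density)

lemma norm_power2_eq_sum_inner_Basis: "(norm (x::'a::euclidean_space))\<^sup>2 = (\<Sum>b\<in>Basis. (x \<bullet> b)\<^sup>2)"
  unfolding power2_norm_eq_inner euclidean_inner[of x x] by (simp add: power2_eq_square)

text \<open>The factorisation over coordinates reduces the total mass and the second moment to
  one-dimensional integrals.\<close>

lemma gauss_density_eq_prod:
  assumes "v > 0"
  shows "gauss_density v x = (\<Prod>b\<in>Basis. normal_density 0 (sqrt v) (x \<bullet> b))"
proof -
  have "(\<Prod>b\<in>Basis. normal_density 0 (sqrt v) (x \<bullet> b)) =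
    (1 / sqrt (2 * pi * v)) ^ DIM('a) * exp (\<Sum>b\<in>Basis. - (x \<bullet> b)\<^sup>2 / (2 * v))"
    using assms by (simp add: normal_density_def prod_dividef exp_sum prod.distrib power_divide)
  also have "(\<Sum>b\<in>Basis. - (x \<bullet> b)\<^sup>2 / (2 * v)) = - (norm x)\<^sup>2 / (2 * v)"
    by (simp add: norm_power2_eq_sum_inner_Basis sum_negf flip: sum_divide_distrib)
  also have "(1 / sqrt (2 * pi * v)) ^ DIM('a) = (2 * pi * v) powr (- real DIM('a) / 2)"
  proof -
    have "(1 / sqrt (2 * pi * v)) = (2 * pi * v) powr (- 1 / 2)"
      using assms by (simp add: powr_half_sqrt[symmetric] powr_minus_divide)
    then show ?thesis
      using assms by (simp add: powr_powr flip: powr_realpow)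
  qed
  finally show ?thesis by (simp add: gauss_density_def)
qed

lemma nn_integral_normal_density:
  "s > 0 \<Longrightarrow> (\<integral>\<^sup>+t. ennreal (normal_density 0 s t) \<partial>lborel) = 1"
  using prob_space.emeasure_space_1[OF prob_space_normal_density[of s 0]]
  by (simp add: emeasure_density)

lemma prob_space_gauss:
  assumes "v > 0"
  shows "prob_space (gauss v :: 'a::euclidean_space measure)"
proof
  have "emeasure (gauss v) (space (gauss v :: 'a measure)) = (\<integral>\<^sup>+x. ennreal (gauss_density v x) \<partial>(lborel :: 'a measure))"
    by (simp add: gauss_def emeasure_density)
  also have "\<dots> = (\<integral>\<^sup>+x. (\<Prod>b\<in>Basis. ennreal (normal_density 0 (sqrt v) (x \<bullet> b))) \<partial>(lborel :: 'a measure))"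
    using assms by (simp add: gauss_density_eq_prod prod_ennreal)
  also have "\<dots> = 1"
    using assms by (subst nn_integral_lborel_prod) (auto simp: nn_integral_normal_density)
  finally show "emeasure (gauss v) (space (gauss v :: 'a measure)) = 1" .
qed

lemma nn_integral_gauss_norm_power2:
  "(\<integral>\<^sup>+x. ennreal ((norm x)\<^sup>2) \<partial>(gauss 1 :: 'a::euclidean_space measure)) = real DIM('a)"
proof -
  have second_moment: "(\<integral>\<^sup>+t. ennreal (t\<^sup>2 * normal_density 0 1 t) \<partial>lborel) = 1"
    using nn_integral_eq_integral[of lborel "\<lambda>t. normal_density 0 1 t * t\<^sup>2"]
      has_bochner_integral_integrable std_normal_moment_even[of 1]
    by (auto simp: has_bochner_integral_iff mult.commute fact_numeral)
  have coord: "(\<integral>\<^sup>+x. ennreal (gauss_density 1 x) * ennreal ((x \<bullet> b)\<^sup>2) \<partial>(lborel :: 'a measure)) = 1" if b: "b \<in> Basis" for b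
  proof -
    \<comment> \<open>The square enters only in coordinate \<open>b\<close>, so every
      one-dimensional integral equals 1: a variance for \<open>b\<close>, a total mass for the
      others.\<close>
    define f where "f = (\<lambda>b' t. ennreal ((if b' = b then t\<^sup>2 else 1) * normal_density 0 1 t))"
    have "ennreal (gauss_density 1 x) * ennreal ((x \<bullet> b)\<^sup>2) = (\<Prod>b'\<in>Basis. f b' (x \<bullet> b'))" for x :: 'a
    proof -
      have "(\<Prod>b'\<in>Basis. f b' (x \<bullet> b')) =
         ennreal ((\<Prod>b'\<in>Basis. if b' = b then (x \<bullet> b')\<^sup>2 else 1) * gauss_density 1 x)"
        by (simp add: f_def prod_ennreal prod.distrib gauss_density_eq_prod)
      then show ?thesis using b by (simp add: prod.delta ennreal_mult mult.commute)
    qed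
    then have "(\<integral>\<^sup>+x. ennreal (gauss_density 1 x) * ennreal ((x \<bullet> b)\<^sup>2) \<partial>(lborel :: 'a measure))
      = (\<integral>\<^sup>+x. (\<Prod>b'\<in>Basis. f b' (x \<bullet> b')) \<partial>(lborel :: 'a measure))" by simp
    also have "\<dots> = (\<Prod>b'\<in>(Basis::'a set). \<integral>\<^sup>+t. f b' t \<partial>lborel)"
      by (rule nn_integral_lborel_prod) (auto simp: f_def)
    also have "\<dots> = 1"
    proof (intro prod.neutral ballI)
      show "(\<integral>\<^sup>+t. f b' t \<partial>lborel) = 1" for b'
        by (cases "b' = b") (simp_all add: f_def second_moment nn_integral_normal_density)
    qed
    finally show ?thesis .
  qed
  have "(\<integral>\<^sup>+x. ennreal ((norm x)\<^sup>2) \<partial>(gauss 1 :: 'a measure))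
    = (\<integral>\<^sup>+x. (\<Sum>b\<in>Basis. ennreal (gauss_density 1 x) * ennreal ((x \<bullet> b)\<^sup>2)) \<partial>(lborel :: 'a measure))"
    by (simp add: nn_integral_gauss norm_power2_eq_sum_inner_Basis sum_ennreal flip: sum_distrib_left)
  also have "\<dots> = real DIM('a)"
    by (subst nn_integral_sum) (auto simp: coord ennreal_of_nat_eq_real_of_nat)
  finally show ?thesis .
qed

lemma distr_gauss_scaleR:
  fixes c v :: real
  assumes c: "c \<noteq> 0" and v: "v > 0"
  shows "distr (gauss v) borel ((*\<^sub>R) c) = (gauss (c\<^sup>2 * v) :: 'a::euclidean_space measure)"
proof (rule measure_eqI)
  fix A assume "A \<in> sets (distr (gauss v) borel ((*\<^sub>R) c :: 'a \<Rightarrow> 'a))"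
  then have [measurable]: "A \<in> sets borel" by simp
  \<comment> \<open>The Jacobian cancels against the power of \<open>c\<^sup>2\<close> in the
    normalising constant.\<close>
  have dens: "ennreal (\<bar>c\<bar> ^ DIM('a)) * ennreal (gauss_density (c\<^sup>2 * v) (c *\<^sub>R x)) = ennreal (gauss_density v x)" for x :: 'a
  proof -
    have "(2 * pi * (c\<^sup>2 * v)) powr (- real DIM('a) / 2) = (\<bar>c\<bar> powr 2) powr (- real DIM('a) / 2) * (2 * pi * v) powr (- real DIM('a) / 2)"
      using c v by (subst powr_mult[symmetric]) (auto simp: mult_ac)
    also have "(\<bar>c\<bar> powr 2) powr (- real DIM('a) / 2) = inverse (\<bar>c\<bar> ^ DIM('a))"
      using c by (simp only: powr_powr) (simp add: powr_minus flip: powr_realpow)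
    finally show ?thesis
      using c v by (simp add: gauss_density_def power_mult_distrib flip: ennreal_mult')
  qed
  have "emeasure (gauss (c\<^sup>2 * v)) A = (\<integral>\<^sup>+x. ennreal (gauss_density (c\<^sup>2 * v) x) * indicator A x \<partial>(lborel :: 'a measure))"
    by (simp add: gauss_def emeasure_density)
  also have "\<dots> = (\<integral>\<^sup>+x. ennreal (gauss_density v x) * indicator A (c *\<^sub>R x) \<partial>(lborel :: 'a measure))"
    using c by (subst nn_integral_lborel_scale[of _ c]) (auto simp: nn_integral_cmult[symmetric] dens mult.assoc[symmetric])
  also have "\<dots> = (\<integral>\<^sup>+x. indicator A (c *\<^sub>R x) \<partial>(gauss v :: 'a measure))"
    by (simp add: nn_integral_gauss)
  also have "\<dots> = emeasure (distr (gauss v) borel ((*\<^sub>R) c)) A"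
    by (subst nn_integral_indicator[symmetric], simp) (simp add: nn_integral_distr del: nn_integral_indicator)
  finally show "emeasure (distr (gauss v) borel ((*\<^sub>R) c)) A = emeasure (gauss (c\<^sup>2 * v)) A" ..
qed simp

lemma mult_exp_product: "(a * exp s) * (b * exp t) = (a * b) * exp (s + t :: real)"
  by (simp add: exp_add mult_ac)

text \<open>Completing the square in \<open>y\<close>: given the sum \<open>z\<close>, the summand
  \<open>y\<close> is Gaussian with mean \<open>(w / (v + w)) *\<^sub>R z\<close> and variance
  \<open>v * w / (v + w)\<close>.\<close>

lemma gauss_density_mult:
  fixes y z :: "'a::euclidean_space"
  assumes v: "v > 0" and w: "w > 0"
  shows "gauss_density w y * gauss_density v (z - y) =
    gauss_density (v + w) z * gauss_density (v * w / (v + w)) (- (w / (v + w)) *\<^sub>R z + y)"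
proof -
  have "- (norm y)\<^sup>2 / (2 * w) + - (norm (z - y))\<^sup>2 / (2 * v) =
    - (norm z)\<^sup>2 / (2 * (v + w)) + - (norm (- (w / (v + w)) *\<^sub>R z + y))\<^sup>2 / (2 * (v * w / (v + w)))"
    unfolding power2_norm_eq_inner inner_simps inner_commute[of y z] using v w
    by (simp add: divide_simps) (simp add: algebra_simps power2_eq_square)
  moreover have "(2 * pi * w) powr (- real DIM('a) / 2) * (2 * pi * v) powr (- real DIM('a) / 2) =
    (2 * pi * (v + w)) powr (- real DIM('a) / 2) * (2 * pi * (v * w / (v + w))) powr (- real DIM('a) / 2)"
  proof -
    have "(2 * pi * w) * (2 * pi * v) = (2 * pi * (v + w)) * (2 * pi * (v * w / (v + w)))"
      using v w by (simp add: field_simps)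
    then show ?thesis
      by (simp only: powr_mult[symmetric])
  qed
  ultimately show ?thesis
    unfolding gauss_density_def mult_exp_product by (simp only:)
qed

text \<open>After substituting \<open>z = x + y\<close> and applying Fubini's theorem, the integral
  over \<open>y\<close> for fixed \<open>z\<close> is the total mass of the conditional Gaussian in
  \<open>gauss_density_mult\<close>.\<close>

lemma nn_integral_gauss_convolution:
  fixes F :: "'a::euclidean_space \<Rightarrow> ennreal"
  assumes [measurable]: "F \<in> borel_measurable borel" and v: "v > 0" and w: "w > 0"
  shows "(\<integral>\<^sup>+y. (\<integral>\<^sup>+x. F (x + y) \<partial>gauss v) \<partial>gauss w) = (\<integral>\<^sup>+z. F z \<partial>gauss (v + w))"
proof -
  define u where "u = v * w / (v + w)"
  have u: "u > 0" using v w by (simp add: u_def)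
  have "(\<integral>\<^sup>+y. (\<integral>\<^sup>+x. F (x + y) \<partial>gauss v) \<partial>gauss w) =
    (\<integral>\<^sup>+y. ennreal (gauss_density w y) * (\<integral>\<^sup>+x. ennreal (gauss_density v x) * F (x + y) \<partial>lborel) \<partial>lborel)"
    by (simp add: nn_integral_gauss)
  also have "\<dots> = (\<integral>\<^sup>+y. (\<integral>\<^sup>+z. ennreal (gauss_density w y * gauss_density v (z - y)) * F z \<partial>lborel) \<partial>lborel)"
  proof (rule nn_integral_cong)
    fix y :: 'a
    have "(\<integral>\<^sup>+x. ennreal (gauss_density v x) * F (x + y) \<partial>lborel) = (\<integral>\<^sup>+z. ennreal (gauss_density v (z - y)) * F z \<partial>lborel)"
      by (subst nn_integral_lborel_translate[of _ y, symmetric]) (simp_all add: add.commute)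
    then show "ennreal (gauss_density w y) * (\<integral>\<^sup>+x. ennreal (gauss_density v x) * F (x + y) \<partial>lborel) =
      (\<integral>\<^sup>+z. ennreal (gauss_density w y * gauss_density v (z - y)) * F z \<partial>lborel)"
      by (simp add: ennreal_mult mult.assoc nn_integral_cmult)
  qed
  also have "\<dots> = (\<integral>\<^sup>+z. (\<integral>\<^sup>+y. ennreal (gauss_density w y * gauss_density v (z - y)) * F z \<partial>lborel) \<partial>lborel)"
    by (rule lborel_pair.Fubini') measurable
  also have "\<dots> = (\<integral>\<^sup>+z. ennreal (gauss_density (v + w) z) * F z \<partial>lborel)"
  proof (rule nn_integral_cong)
    fix z :: 'a
    have "(\<integral>\<^sup>+y. ennreal (gauss_density u (- (w / (v + w)) *\<^sub>R z + y)) \<partial>lborel) = (\<integral>\<^sup>+y. ennreal (gauss_density u (y::'a)) \<partial>lborel)"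
      by (rule nn_integral_lborel_translate) simp
    also have "\<dots> = 1"
      using prob_space.emeasure_space_1[OF prob_space_gauss[OF u, where ?'a = 'a]] by (simp add: gauss_def emeasure_density)
    finally show "(\<integral>\<^sup>+y. ennreal (gauss_density w y * gauss_density v (z - y)) * F z \<partial>lborel) = ennreal (gauss_density (v + w) z) * F z"
      using gauss_density_mult[OF v w, of _ z] by (simp add: ennreal_mult u_def nn_integral_cmult nn_integral_multc)
  qed
  finally show ?thesis by (simp add: nn_integral_gauss)
qed

subsection \<open>Comparison of one summand\<close>

definition uniform_sphere_law :: "'a::euclidean_space measure \<Rightarrow> bool" where
  "uniform_sphere_law \<sigma> \<longleftrightarrow> prob_space \<sigma> \<and> sets \<sigma> = sets borel \<and>
     (\<forall>A \<in> sets borel. measure \<sigma> A = measure lborel (cone_of A) / measure lborel (ball (0::'a) 1))"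

lemma uniform_sphere_law_distr:
  assumes "prob_space M" "uniform_on_sphere M X"
  shows "uniform_sphere_law (distr M borel X)"
  using assms prob_space.prob_space_distr[of M X borel]
  by (auto simp: uniform_sphere_law_def uniform_on_sphere_def measure_distr)

text \<open>Polar coordinates split the integral into a directional and a radial factor, so
  reweighting by a function of the norm leaves the direction uniform. The weight 1 and the
  normalised squared norm together supply what Jensen's inequality needs of the independence of
  radius and direction.\<close>

lemma distr_density_gauss_sgn:
  fixes \<sigma> :: "'a::euclidean_space measure"
  assumes \<sigma>: "uniform_sphere_law \<sigma>"
    and F[measurable]: "F \<in> borel_measurable borel"
    and F1: "(\<integral>\<^sup>+x. F ((norm x)\<^sup>2) \<partial>(gauss 1 :: 'a measure)) = 1"
  shows "distr (density (gauss 1) (\<lambda>x. F ((norm x)\<^sup>2))) borel sgn = \<sigma>"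
proof (rule measure_eqI)
  interpret \<sigma>: prob_space \<sigma> using \<sigma> by (simp add: uniform_sphere_law_def)
  have sets\<sigma>: "sets \<sigma> = sets borel" and
    meas: "\<And>A. A \<in> sets borel \<Longrightarrow> measure \<sigma> A = measure lborel (cone_of A) / measure lborel (ball (0::'a) 1)"
    using \<sigma> by (auto simp: uniform_sphere_law_def)
  show "sets (distr (density (gauss 1) (\<lambda>x. F ((norm x)\<^sup>2))) borel sgn) = sets \<sigma>"
    by (simp add: sets\<sigma>)
  define h where "h = (\<lambda>w. ennreal ((2 * pi) powr (- real DIM('a) / 2) * exp (- w / 2)) * F w)"
  have [measurable]: "h \<in> borel_measurable borel" unfolding h_def by measurable
  define J where "J = (\<integral>\<^sup>+w. ennreal (DIM('a) / 2 * w powr (DIM('a) / 2 - 1)) * indicator {0<..} w * h w \<partial>lborel)"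
  have polar: "(\<integral>\<^sup>+x. indicator A (sgn x) * F ((norm x)\<^sup>2) \<partial>(gauss 1 :: 'a measure)) = emeasure lborel (cone_of A) * J"
    if [measurable]: "A \<in> sets borel" for A :: "'a set"
  proof -
    have "(\<integral>\<^sup>+x. indicator A (sgn x) * F ((norm x)\<^sup>2) \<partial>(gauss 1 :: 'a measure))
      = (\<integral>\<^sup>+x. indicator A (sgn x) * h ((norm x)\<^sup>2) \<partial>lborel)"
      by (simp add: nn_integral_gauss gauss_density_def h_def mult_ac)
    also have "\<dots> = emeasure lborel (cone_of A) * J"
      unfolding J_def by (rule nn_integral_polar) auto
    finally show ?thesis .
  qed
  have cone: "emeasure lborel (cone_of A) = ennreal (measure lborel (cone_of A))" for A :: "'a set"
    using emeasure_cone_of_finite[of A] by (intro emeasure_eq_ennreal_measure) auto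
  \<comment> \<open>The volume of the full cone is read off from the total mass 1 of
    \<sigma>.\<close>
  have U: "measure lborel (cone_of (UNIV :: 'a set)) = measure lborel (ball (0::'a) 1)"
    using meas[of UNIV] \<sigma>.prob_space sets_eq_imp_space_eq[OF sets\<sigma>] by (simp add: field_simps split: if_splits)
  \<comment> \<open>The normalisation \<open>F1\<close> makes the radial factor \<open>J\<close> the
    reciprocal of the volume of the ball.\<close>
  have "ennreal (measure lborel (ball (0::'a) 1)) * J = 1"
    using polar[of UNIV] F1 by (simp add: cone U)
  then obtain j where j: "J = ennreal j" "j \<ge> 0" "measure lborel (ball (0::'a) 1) * j = 1"
    by (cases J) (auto simp: ennreal_mult_top ennreal_mult_eq_top_iff simp flip: ennreal_mult' split: if_splits)
  fix A assume "A \<in> sets (distr (density (gauss 1) (\<lambda>x. F ((norm x)\<^sup>2))) borel (sgn :: 'a \<Rightarrow> 'a))"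
  then have [measurable]: "A \<in> sets borel" by simp
  have "emeasure (distr (density (gauss 1) (\<lambda>x. F ((norm x)\<^sup>2))) borel sgn) A
     = (\<integral>\<^sup>+x. indicator A x \<partial>(distr (density (gauss 1) (\<lambda>x. F ((norm x)\<^sup>2))) borel sgn))"
    by simp
  also have "\<dots> = (\<integral>\<^sup>+x. indicator A (sgn x) * F ((norm x)\<^sup>2) \<partial>(gauss 1 :: 'a measure))"
    by (subst nn_integral_distr, measurable) (simp add: nn_integral_density mult.commute)
  also have "\<dots> = emeasure lborel (cone_of A) * J"
    by (rule polar) simp
  also have "\<dots> = emeasure \<sigma> A"
  proof -
    have "j = 1 / measure lborel (ball (0::'a) 1)"
      using j(3) by (metis nonzero_eq_divide_eq mult.commute mult_zero_left zero_neq_one)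
    then show ?thesis
      by (simp add: \<sigma>.emeasure_eq_measure meas cone j(1,2) flip: ennreal_mult')
  qed
  finally show "emeasure (distr (density (gauss 1) (\<lambda>x. F ((norm x)\<^sup>2))) borel sgn) A = emeasure \<sigma> A" .
qed

lemma distr_gauss_sgn:
  assumes "uniform_sphere_law \<sigma>"
  shows "distr (gauss 1) borel sgn = \<sigma>"
  using distr_density_gauss_sgn[OF assms, of "\<lambda>_. 1"] prob_space.emeasure_space_1[OF prob_space_gauss[of 1]]
  by (simp add: density_1)

lemma distr_gauss_norm_power2_sgn:
  fixes \<sigma> :: "'a::euclidean_space measure"
  assumes "uniform_sphere_law \<sigma>"
  shows "distr (density (gauss 1) (\<lambda>x. ennreal ((norm x)\<^sup>2 / DIM('a)))) borel sgn = \<sigma>"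
proof (rule distr_density_gauss_sgn[OF assms, of "\<lambda>w. ennreal (w / DIM('a))"])
  have "(\<integral>\<^sup>+x. ennreal ((norm x)\<^sup>2 / DIM('a)) \<partial>(gauss 1 :: 'a measure)) =
     (\<integral>\<^sup>+x. ennreal (1 / DIM('a)) * ennreal ((norm x)\<^sup>2) \<partial>(gauss 1 :: 'a measure))"
    by (simp flip: ennreal_mult')
  also have "\<dots> = 1"
    by (subst nn_integral_cmult) (auto simp: nn_integral_gauss_norm_power2 simp flip: ennreal_mult')
  finally show "(\<integral>\<^sup>+x. ennreal ((norm x)\<^sup>2 / DIM('a)) \<partial>(gauss 1 :: 'a measure)) = 1" .
qed simp

lemma distr_gauss_uminus:
  assumes "v > 0"
  shows "distr (gauss v) borel uminus = (gauss v :: 'a::euclidean_space measure)"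
proof -
  have "(*\<^sub>R) (-1) = (uminus :: 'a \<Rightarrow> 'a)" by (simp add: fun_eq_iff)
  then show ?thesis using distr_gauss_scaleR[of "-1" v, where ?'a = 'a] assms by simp
qed

text \<open>The symmetry is inherited from the Gaussian, since \<open>sgn\<close> is odd.\<close>

lemma distr_uniform_sphere_law_uminus:
  assumes "uniform_sphere_law \<sigma>"
  shows "distr \<sigma> borel uminus = \<sigma>"
proof -
  have "distr \<sigma> borel uminus = distr (gauss 1) borel (uminus \<circ> sgn)"
    unfolding distr_gauss_sgn[OF assms, symmetric] by (subst distr_distr) auto
  also have "uminus \<circ> sgn = (sgn \<circ> uminus :: 'a \<Rightarrow> 'a)"
    by (simp add: fun_eq_iff sgn_minus)
  also have "distr (gauss 1) borel (sgn \<circ> uminus) = distr (distr (gauss 1) borel uminus) borel sgn"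
    by (subst distr_distr) auto
  finally show ?thesis by (simp add: distr_gauss_uminus distr_gauss_sgn[OF assms])
qed

section \<open>Truncated cubes under a spherical and under a Gaussian step\<close>

definition excess_cube :: "real \<Rightarrow> 'a::real_normed_vector \<Rightarrow> real" where
  "excess_cube s x = max 0 ((norm x)\<^sup>2 - s) ^ 3"

lemma excess_cube_nonneg [simp]: "excess_cube s x \<ge> 0"
  by (simp add: excess_cube_def)

lemma excess_cube_measurable [measurable]:
  "excess_cube s \<in> borel_measurable (borel :: 'a::euclidean_space measure)"
  unfolding excess_cube_def[abs_def] by measurable

text \<open>The derivative of \<open>excess_cube s (x + a e) + excess_cube s (x - a e)\<close> with respect to \<open>a\<^sup>2\<close>,
  for a unit vector \<open>e\<close>.\<close>
definition excess_slope :: "real \<Rightarrow> 'a::euclidean_space \<Rightarrow> real \<Rightarrow> 'a \<Rightarrow> real" where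
  "excess_slope s x a e =
     (6 * (x \<bullet> e + a) * max 0 ((norm (x + a *\<^sub>R e))\<^sup>2 - s) ^ 2
    - 6 * (x \<bullet> e - a) * max 0 ((norm (x - a *\<^sub>R e))\<^sup>2 - s) ^ 2) / (2 * a)"

lemma excess_cube_ge_tangent:
  fixes x e :: "'a::euclidean_space"
  assumes e: "norm e = 1" and "a > 0" "r \<ge> 0"
  shows "excess_cube s (x + r *\<^sub>R e) + excess_cube s (x - r *\<^sub>R e) \<ge>
    excess_cube s (x + a *\<^sub>R e) + excess_cube s (x - a *\<^sub>R e) + excess_slope s x a e * (r\<^sup>2 - a\<^sup>2)"
proof -
  \<comment> \<open>On the line through \<open>x\<close> in direction \<open>e\<close> the squared
    norm is \<open>(c + r)\<^sup>2 + (norm x)\<^sup>2 - c\<^sup>2\<close>; \<open>q\<close> collects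
    the terms without \<open>r\<close>.\<close>
  define c q where "c = x \<bullet> e" and "q = (norm x)\<^sup>2 - c\<^sup>2 - s"
  have "e \<bullet> e = 1" using e by (simp add: norm_eq_1)
  then have p: "(norm (x + r *\<^sub>R e))\<^sup>2 - s = (c + r)\<^sup>2 + q" "(norm (x - r *\<^sub>R e))\<^sup>2 - s = (c - r)\<^sup>2 + q" for r
    unfolding q_def c_def power2_norm_eq_inner
    by (simp_all add: inner_simps inner_commute[of e x] power2_eq_square algebra_simps)
  show ?thesis
    unfolding excess_cube_def excess_slope_def p c_def[symmetric]
    by (rule cube_symmetric_sum_ge_tangent) fact+
qed

text \<open>Jensen's inequality in tangent form: the tangent inequality at radius \<open>a\<close>
  is applied with direction \<open>sgn y\<close> and radius \<open>a * norm y / sqrt d\<close>, then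
  integrated over Gaussian \<open>y\<close>. The linear term integrates to 0, and by symmetry of
  both laws the symmetrised sums integrate to twice the two sides.\<close>

lemma excess_cube_sphere_le_gauss_pos:
  fixes \<sigma> :: "'a::euclidean_space measure" and x :: 'a
  assumes \<sigma>: "uniform_sphere_law \<sigma>" and a: "a > 0"
  shows "(\<integral>\<^sup>+y. ennreal (excess_cube s (x + a *\<^sub>R y)) \<partial>\<sigma>)
    \<le> (\<integral>\<^sup>+y. ennreal (excess_cube s (x + (a / sqrt DIM('a)) *\<^sub>R y)) \<partial>gauss 1)"
\<comment> \<open>An infinite right side leaves nothing to prove; a finite one makes \<phi>
  integrable, so Bochner integrals, which allow subtraction, are available.\<close>
proof (cases "(\<integral>\<^sup>+y. ennreal (excess_cube s (x + (a / sqrt DIM('a)) *\<^sub>R y)) \<partial>gauss 1) = \<infinity>")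
  case False
  define f :: "'a \<Rightarrow> real" where "f = excess_cube s"
  define d where "d = real DIM('a)"
  define \<gamma> where "\<gamma> = (gauss 1 :: 'a measure)"
  define \<phi> where "\<phi> = (\<lambda>y. f (x + (a / sqrt d) *\<^sub>R y))"
  define u where "u = (\<lambda>e. f (x + a *\<^sub>R e) + f (x - a *\<^sub>R e))"
  define \<kappa> where "\<kappa> = excess_slope s x a"
  have d: "d > 0" by (simp add: d_def)
  interpret \<gamma>: prob_space \<gamma> unfolding \<gamma>_def by (rule prob_space_gauss) simp
  interpret \<sigma>: prob_space \<sigma> using \<sigma> by (simp add: uniform_sphere_law_def)
  have sets\<gamma>[measurable_cong]: "sets \<gamma> = sets borel" by (simp add: \<gamma>_def)
  have sets\<sigma>[measurable_cong]: "sets \<sigma> = sets borel" using \<sigma> by (simp add: uniform_sphere_law_def)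
  have [measurable]: "f \<in> borel_measurable borel" by (simp add: f_def)
  have f0: "f y \<ge> 0" for y by (simp add: f_def)
  have [measurable]: "\<phi> \<in> borel_measurable borel" "u \<in> borel_measurable borel" "\<kappa> \<in> borel_measurable borel"
    unfolding \<phi>_def u_def \<kappa>_def excess_slope_def[abs_def] by measurable
  \<comment> \<open>The closed ball is used instead of the sphere because \<open>sgn 0 = 0\<close>.
    Boundedness there makes functions of \<open>sgn y\<close> integrable.\<close>
  have bounded: "\<exists>K. \<forall>e. norm e \<le> 1 \<longrightarrow> norm (h e) \<le> K" if "continuous_on (cball 0 1) h" for h :: "'a \<Rightarrow> real"
    using compact_imp_bounded[OF compact_continuous_image[OF that compact_cball]]
    by (force simp: bounded_iff)
  have "continuous_on (cball 0 1) u" "continuous_on (cball 0 1) (\<lambda>e. f (x + a *\<^sub>R e))" "continuous_on (cball 0 1) \<kappa>"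
    unfolding u_def f_def excess_cube_def \<kappa>_def excess_slope_def[abs_def] using a
    by (auto intro!: continuous_intros)
  from this[THEN bounded] obtain Ku K\<kappa> Kf where K: "\<And>e. norm e \<le> 1 \<Longrightarrow> \<bar>u e\<bar> \<le> Ku" "\<And>e. norm e \<le> 1 \<Longrightarrow> \<bar>\<kappa> e\<bar> \<le> K\<kappa>"
     "\<And>e. norm e \<le> 1 \<Longrightarrow> \<bar>f (x + a *\<^sub>R e)\<bar> \<le> Kf"
    by auto
  have sgn1: "norm (sgn y) \<le> 1" for y :: 'a by (simp add: norm_sgn)
  have int\<phi>: "integrable \<gamma> \<phi>"
    using False by (intro integrableI_nonneg) (auto simp: \<phi>_def f_def d_def \<gamma>_def less_top)
  have neg\<phi>: "integrable \<gamma> (\<lambda>y. \<phi> (- y))" "(\<integral>y. \<phi> (- y) \<partial>\<gamma>) = (\<integral>y. \<phi> y \<partial>\<gamma>)"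
    using int\<phi> integrable_distr_eq[of uminus \<gamma> borel \<phi>] integral_distr[of uminus \<gamma> borel \<phi>]
    by (simp_all add: \<gamma>_def distr_gauss_uminus)
  have intu: "integrable \<gamma> (\<lambda>y. u (sgn y))"
    by (rule \<gamma>.integrable_const_bound[where B = Ku]) (auto simp: K sgn1)
  have int\<kappa>: "integrable \<gamma> (\<lambda>y. \<kappa> (sgn y))"
    by (rule \<gamma>.integrable_const_bound[where B = K\<kappa>]) (auto simp: K sgn1)
  have intn: "integrable \<gamma> (\<lambda>y. (norm y)\<^sup>2 / d)"
    using nn_integral_gauss_norm_power2[where ?'a = 'a]
    by (intro integrable_divide integrableI_nonneg) (auto simp: \<gamma>_def)
  have int\<kappa>n: "integrable \<gamma> (\<lambda>y. (norm y)\<^sup>2 / d * \<kappa> (sgn y))"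
  proof (rule Bochner_Integration.integrable_bound)
    show "integrable \<gamma> (\<lambda>y. (norm y)\<^sup>2 / d * K\<kappa>)" using intn by (rule integrable_mult_left)
    show "AE y in \<gamma>. norm ((norm y)\<^sup>2 / d * \<kappa> (sgn y)) \<le> norm ((norm y)\<^sup>2 / d * K\<kappa>)"
      using K(2)[OF sgn1] d
      by (intro AE_I2) (auto simp: abs_mult intro!: mult_mono divide_right_mono order.trans[OF K(2)[OF sgn1] abs_ge_self])
  qed simp
  \<comment> \<open>The weights \<open>(norm y)\<^sup>2 / d\<close> and 1 give \<open>sgn y\<close>
    the same law \<sigma>, which makes the linear term of the tangent integrate to 0.\<close>
  have "(\<integral>y. (norm y)\<^sup>2 / d * \<kappa> (sgn y) \<partial>\<gamma>) = (\<integral>y. \<kappa> (sgn y) \<partial>density \<gamma> (\<lambda>y. ennreal ((norm y)\<^sup>2 / d)))"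
    using d by (subst integral_real_density) auto
  also have "\<dots> = (\<integral>e. \<kappa> e \<partial>\<sigma>)"
    unfolding distr_gauss_norm_power2_sgn[OF \<sigma>, symmetric] d_def \<gamma>_def by (subst integral_distr) auto
  also have "\<dots> = (\<integral>y. \<kappa> (sgn y) \<partial>\<gamma>)"
    unfolding distr_gauss_sgn[OF \<sigma>, symmetric] \<gamma>_def by (subst integral_distr) auto
  finally have slope0: "(\<integral>y. (norm y)\<^sup>2 / d * \<kappa> (sgn y) \<partial>\<gamma>) = (\<integral>y. \<kappa> (sgn y) \<partial>\<gamma>)" .
  have intf: "integrable \<sigma> (\<lambda>e. f (x + (c * a) *\<^sub>R e))" if "c \<in> {1, -1}" for c
    unfolding distr_gauss_sgn[OF \<sigma>, symmetric] \<gamma>_def[symmetric] using K(3)[of "c *\<^sub>R sgn y" for y] that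
    by (subst integrable_distr_eq) (auto intro!: \<gamma>.integrable_const_bound[where B = Kf] simp: norm_sgn)
  have "(\<integral>y. u (sgn y) \<partial>\<gamma>) = (\<integral>e. u e \<partial>\<sigma>)"
    unfolding distr_gauss_sgn[OF \<sigma>, symmetric] \<gamma>_def by (subst integral_distr) auto
  also have "\<dots> = (\<integral>e. f (x + a *\<^sub>R e) \<partial>\<sigma>) + (\<integral>e. f (x - a *\<^sub>R e) \<partial>\<sigma>)"
    unfolding u_def using intf[of 1] intf[of "-1"] by (intro Bochner_Integration.integral_add) auto
  also have "(\<integral>e. f (x - a *\<^sub>R e) \<partial>\<sigma>) = (\<integral>e. f (x + a *\<^sub>R e) \<partial>\<sigma>)"
    by (subst (2) distr_uniform_sphere_law_uminus[OF \<sigma>, symmetric]) (subst integral_distr, auto)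
  finally have u2: "(\<integral>y. u (sgn y) \<partial>\<gamma>) = 2 * (\<integral>e. f (x + a *\<^sub>R e) \<partial>\<sigma>)" by simp
  have "(\<integral>y. u (sgn y) + a\<^sup>2 * ((norm y)\<^sup>2 / d * \<kappa> (sgn y) - \<kappa> (sgn y)) \<partial>\<gamma>) \<le> (\<integral>y. \<phi> y + \<phi> (- y) \<partial>\<gamma>)"
  proof (rule integral_mono_AE)
    \<comment> \<open>The origin is discarded since the tangent inequality requires
      \<open>sgn y\<close> to be a unit vector.\<close>
    have "AE y in \<gamma>. y \<noteq> 0"
      unfolding \<gamma>_def gauss_def by (subst AE_density) (use AE_lborel_singleton[of "0::'a"] in auto)
    then show "AE y in \<gamma>. u (sgn y) + a\<^sup>2 * ((norm y)\<^sup>2 / d * \<kappa> (sgn y) - \<kappa> (sgn y)) \<le> \<phi> y + \<phi> (- y)"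
    proof eventually_elim
      case (elim y)
      define r where "r = a * norm y / sqrt d"
      have "r \<ge> 0" using a d by (simp add: r_def)
      have ry: "r *\<^sub>R sgn y = (a / sqrt d) *\<^sub>R y" using elim by (simp add: r_def sgn_div_norm)
      have r2: "r\<^sup>2 = a\<^sup>2 * ((norm y)\<^sup>2 / d)" using d by (simp add: r_def power_divide power_mult_distrib)
      have "u (sgn y) + \<kappa> (sgn y) * (r\<^sup>2 - a\<^sup>2) \<le> \<phi> y + \<phi> (- y)"
        using excess_cube_ge_tangent[OF _ a \<open>r \<ge> 0\<close>, of "sgn y" s x] elim
        by (simp add: u_def \<kappa>_def \<phi>_def f_def ry norm_sgn)
      then show ?case by (simp add: r2 algebra_simps)
    qed
  qed (intro Bochner_Integration.integrable_add integrable_mult_right Bochner_Integration.integrable_diff int\<phi> neg\<phi> intu int\<kappa>n int\<kappa>)+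
  then have "(\<integral>e. f (x + a *\<^sub>R e) \<partial>\<sigma>) \<le> (\<integral>y. \<phi> y \<partial>\<gamma>)"
    using int\<phi> neg\<phi> intu int\<kappa>n int\<kappa> slope0 u2 by simp
  moreover have "(\<integral>\<^sup>+e. ennreal (f (x + a *\<^sub>R e)) \<partial>\<sigma>) = ennreal (\<integral>e. f (x + a *\<^sub>R e) \<partial>\<sigma>)"
    using intf[of 1] by (intro nn_integral_eq_integral) (auto simp: f0)
  moreover have "(\<integral>\<^sup>+y. ennreal (\<phi> y) \<partial>\<gamma>) = ennreal (\<integral>y. \<phi> y \<partial>\<gamma>)"
    using int\<phi> by (intro nn_integral_eq_integral) (auto simp: \<phi>_def f0)
  ultimately show ?thesis
    by (simp add: \<phi>_def f_def \<gamma>_def d_def ennreal_leI)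
qed simp

lemma excess_cube_sphere_le_gauss:
  fixes \<sigma> :: "'a::euclidean_space measure" and x :: 'a
  assumes \<sigma>: "uniform_sphere_law \<sigma>"
  shows "(\<integral>\<^sup>+y. ennreal (excess_cube s (x + a *\<^sub>R y)) \<partial>\<sigma>)
    \<le> (\<integral>\<^sup>+y. ennreal (excess_cube s (x + (a / sqrt DIM('a)) *\<^sub>R y)) \<partial>gauss 1)"
proof -
  interpret \<sigma>: prob_space \<sigma> using \<sigma> by (simp add: uniform_sphere_law_def)
  have [measurable_cong]: "sets \<sigma> = sets borel" using \<sigma> by (simp add: uniform_sphere_law_def)
  consider "a > 0" | "a = 0" | "a < 0" by linarith
  then show ?thesis
  proof cases
    case 1
    then show ?thesis by (rule excess_cube_sphere_le_gauss_pos[OF \<sigma>])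
  next
    case 2
    then show ?thesis
      using prob_space.emeasure_space_1[OF prob_space_gauss[of 1, where ?'a = 'a]] \<sigma>.emeasure_space_1 by simp
  next
    case 3
    have "(\<integral>\<^sup>+y. ennreal (excess_cube s (x + a *\<^sub>R y)) \<partial>\<sigma>) = (\<integral>\<^sup>+y. ennreal (excess_cube s (x + (- a) *\<^sub>R y)) \<partial>\<sigma>)"
      by (subst distr_uniform_sphere_law_uminus[OF \<sigma>, symmetric]) (subst nn_integral_distr, auto)
    also have "\<dots> \<le> (\<integral>\<^sup>+y. ennreal (excess_cube s (x + (- a / sqrt DIM('a)) *\<^sub>R y)) \<partial>gauss 1)"
      using 3 by (intro excess_cube_sphere_le_gauss_pos[OF \<sigma>]) simp
    also have "\<dots> = (\<integral>\<^sup>+y. ennreal (excess_cube s (x + (a / sqrt DIM('a)) *\<^sub>R y)) \<partial>gauss 1)"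
      by (subst distr_gauss_uminus[OF zero_less_one, symmetric]) (subst nn_integral_distr, auto)
    finally show ?thesis .
  qed
qed

subsection \<open>Sums of independent vectors\<close>

lemma (in prob_space) indep_vars_sum_euclidean:
  fixes X :: "'i \<Rightarrow> 'a \<Rightarrow> 'b::euclidean_space"
  assumes I: "finite I" "i \<notin> I" and indep: "indep_vars (\<lambda>_. borel) X (insert i I)"
  shows "indep_var borel (X i) borel (\<lambda>\<omega>. \<Sum>i\<in>I. X i \<omega>)"
proof -
  have "indep_var
    borel ((\<lambda>f. f i) \<circ> (\<lambda>\<omega>. restrict (\<lambda>i. X i \<omega>) {i}))
    borel ((\<lambda>f. \<Sum>i\<in>I. f i) \<circ> (\<lambda>\<omega>. restrict (\<lambda>i. X i \<omega>) I))"
    using I by (intro indep_var_compose[OF indep_var_restrict[OF indep]]) auto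
  then show ?thesis
    by (simp add: o_def cong: sum.cong)
qed

lemma (in prob_space) nn_integral_indep_var_add:
  fixes X Y :: "'a \<Rightarrow> 'b::euclidean_space"
  assumes indep: "indep_var borel X borel Y" and [measurable]: "F \<in> borel_measurable borel"
  shows "(\<integral>\<^sup>+\<omega>. F (X \<omega> + Y \<omega>) \<partial>M) = (\<integral>\<^sup>+\<omega>. (\<integral>\<^sup>+\<omega>'. F (X \<omega> + Y \<omega>') \<partial>M) \<partial>M)"
proof -
  have rv[measurable]: "random_variable borel X" "random_variable borel Y"
    using indep by (auto dest: indep_var_rv1 indep_var_rv2)
  interpret Y: prob_space "distr M borel Y" by (rule prob_space_distr) simp
  have "(\<integral>\<^sup>+\<omega>. F (X \<omega> + Y \<omega>) \<partial>M) = (\<integral>\<^sup>+p. F (fst p + snd p) \<partial>distr M (borel \<Otimes>\<^sub>M borel) (\<lambda>\<omega>. (X \<omega>, Y \<omega>)))"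
    by (subst nn_integral_distr) auto
  also have "distr M (borel \<Otimes>\<^sub>M borel) (\<lambda>\<omega>. (X \<omega>, Y \<omega>)) = distr M borel X \<Otimes>\<^sub>M distr M borel Y"
    using indep by (simp add: indep_var_distribution_eq)
  also have "(\<integral>\<^sup>+p. F (fst p + snd p) \<partial>(distr M borel X \<Otimes>\<^sub>M distr M borel Y)) =
     (\<integral>\<^sup>+x. (\<integral>\<^sup>+y. F (x + y) \<partial>distr M borel Y) \<partial>distr M borel X)"
    by (subst Y.nn_integral_fst[symmetric]) auto
  also have "\<dots> = (\<integral>\<^sup>+\<omega>. (\<integral>\<^sup>+\<omega>'. F (X \<omega> + Y \<omega>') \<partial>M) \<partial>M)"
    by (subst nn_integral_distr, simp, measurable) (simp add: nn_integral_distr)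
  finally show ?thesis .
qed

text \<open>Replacement of one summand at a time. The comparison is assumed for every translate
  \<open>x\<close> because the remaining summands act as a random translation; Fubini's theorem on
  the product of \<open>M\<close> and \<open>N\<close> lets sums from both spaces be mixed.\<close>

lemma nn_integral_indep_sum_le:
  fixes X :: "'i \<Rightarrow> 'p \<Rightarrow> 'b::euclidean_space" and Y :: "'i \<Rightarrow> 'q \<Rightarrow> 'b"
  assumes "prob_space M" "prob_space N"
    and F[measurable]: "F \<in> borel_measurable borel"
    and fin: "finite I"
    and "prob_space.indep_vars M (\<lambda>_. borel) X I" "prob_space.indep_vars N (\<lambda>_. borel) Y I"
    and le: "\<And>i x. i \<in> I \<Longrightarrow> (\<integral>\<^sup>+\<omega>. F (x + X i \<omega>) \<partial>M) \<le> (\<integral>\<^sup>+\<omega>. F (x + Y i \<omega>) \<partial>N)"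
  shows "(\<integral>\<^sup>+\<omega>. F (x + (\<Sum>i\<in>I. X i \<omega>)) \<partial>M) \<le> (\<integral>\<^sup>+\<omega>. F (x + (\<Sum>i\<in>I. Y i \<omega>)) \<partial>N)"
proof -
  interpret M: prob_space M by fact
  interpret N: prob_space N by fact
  interpret MN: pair_sigma_finite M N ..
  show ?thesis
    using fin assms(5-7)
  proof (induction I arbitrary: x rule: finite_induct)
    case empty
    then show ?case by (simp add: M.emeasure_space_1 N.emeasure_space_1)
  next
    case (insert i I)
    have "\<And>j. j \<in> insert i I \<Longrightarrow> X j \<in> borel_measurable M" "\<And>j. j \<in> insert i I \<Longrightarrow> Y j \<in> borel_measurable N"
      using insert.prems by (auto simp: M.indep_vars_def N.indep_vars_def)
    then have [measurable]: "X i \<in> borel_measurable M" "Y i \<in> borel_measurable N"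
      "(\<lambda>\<omega>. \<Sum>j\<in>I. X j \<omega>) \<in> borel_measurable M" "(\<lambda>\<omega>. \<Sum>j\<in>I. Y j \<omega>) \<in> borel_measurable N"
      by (auto intro!: borel_measurable_sum)
    have IH: "(\<integral>\<^sup>+\<omega>. F (x + (\<Sum>i\<in>I. X i \<omega>)) \<partial>M) \<le> (\<integral>\<^sup>+\<omega>. F (x + (\<Sum>i\<in>I. Y i \<omega>)) \<partial>N)" for x
      using insert.prems by (intro insert.IH M.indep_vars_subset[of _ _ "insert i I" I] N.indep_vars_subset[of _ _ "insert i I" I]) auto
    have "(\<integral>\<^sup>+\<omega>. F (x + (\<Sum>i\<in>insert i I. X i \<omega>)) \<partial>M) = (\<integral>\<^sup>+\<omega>. (\<integral>\<^sup>+\<omega>'. F (x + (X i \<omega> + (\<Sum>i\<in>I. X i \<omega>'))) \<partial>M) \<partial>M)"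
      using insert.hyps
      by (simp add: M.nn_integral_indep_var_add[OF M.indep_vars_sum_euclidean[OF insert.hyps insert.prems(1)], of "\<lambda>z. F (x + z)"])
    \<comment> \<open>The induction hypothesis at the translate \<open>x + X i \<omega>\<close>
      replaces all summands but the one at \<open>i\<close>.\<close>
    also have "\<dots> \<le> (\<integral>\<^sup>+\<omega>. (\<integral>\<^sup>+\<omega>'. F (x + X i \<omega> + (\<Sum>i\<in>I. Y i \<omega>')) \<partial>N) \<partial>M)"
      by (intro nn_integral_mono) (simp add: IH flip: add.assoc)
    also have "\<dots> = (\<integral>\<^sup>+\<omega>'. (\<integral>\<^sup>+\<omega>. F (x + X i \<omega> + (\<Sum>i\<in>I. Y i \<omega>')) \<partial>M) \<partial>N)"
      by (rule MN.Fubini'[symmetric]) measurable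
    \<comment> \<open>With the order of integration exchanged, the sum over \<open>I\<close> is a
      fixed translation and the single-summand comparison applies to \<open>X i\<close>.\<close>
    also have "\<dots> \<le> (\<integral>\<^sup>+\<omega>'. (\<integral>\<^sup>+\<omega>. F (x + Y i \<omega> + (\<Sum>i\<in>I. Y i \<omega>')) \<partial>N) \<partial>N)"
    proof (rule nn_integral_mono)
      fix \<omega>'
      show "(\<integral>\<^sup>+\<omega>. F (x + X i \<omega> + (\<Sum>i\<in>I. Y i \<omega>')) \<partial>M) \<le> (\<integral>\<^sup>+\<omega>. F (x + Y i \<omega> + (\<Sum>i\<in>I. Y i \<omega>')) \<partial>N)"
        using insert.prems(3)[of i "x + (\<Sum>i\<in>I. Y i \<omega>')"] by (simp add: ac_simps)
    qed
    also have "\<dots> = (\<integral>\<^sup>+\<omega>. (\<integral>\<^sup>+\<omega>'. F (x + Y i \<omega> + (\<Sum>i\<in>I. Y i \<omega>')) \<partial>N) \<partial>N)"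
    proof -
      interpret NN: pair_sigma_finite N N ..
      show ?thesis by (rule NN.Fubini') measurable
    qed
    also have "\<dots> = (\<integral>\<^sup>+\<omega>. F (x + (\<Sum>i\<in>insert i I. Y i \<omega>)) \<partial>N)"
      using insert.hyps
      by (simp add: N.nn_integral_indep_var_add[OF N.indep_vars_sum_euclidean[OF insert.hyps insert.prems(2)], of "\<lambda>z. F (x + z)"] add.assoc)
    finally show ?case .
  qed
qed

lemma (in prob_space) distr_sum_gauss:
  fixes G :: "'i \<Rightarrow> 'a \<Rightarrow> 'b::euclidean_space" and a :: "'i \<Rightarrow> real"
  assumes "finite I" "indep_vars (\<lambda>_. borel) G I" "\<And>i. i \<in> I \<Longrightarrow> distr M borel (G i) = gauss 1"
    and "(\<Sum>i\<in>I. (a i)\<^sup>2) > 0"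
  shows "distr M borel (\<lambda>\<omega>. \<Sum>i\<in>I. a i *\<^sub>R G i \<omega>) = gauss (\<Sum>i\<in>I. (a i)\<^sup>2)"
  using assms
proof (induction I rule: finite_induct)
  case (insert i I)
  have rv: "\<And>j. j \<in> insert i I \<Longrightarrow> G j \<in> borel_measurable M"
    using insert.prems by (auto simp: indep_vars_def)
  then have [measurable]: "G i \<in> borel_measurable M" "(\<lambda>\<omega>. \<Sum>j\<in>I. a j *\<^sub>R G j \<omega>) \<in> borel_measurable M"
    by (auto intro!: borel_measurable_sum borel_measurable_scaleR)
  have Gi: "distr M borel (\<lambda>\<omega>. a i *\<^sub>R G i \<omega>) = gauss ((a i)\<^sup>2)" if "a i \<noteq> 0"
    using distr_gauss_scaleR[OF that zero_less_one, where ?'a = 'b] insert.prems(2)[of i, symmetric]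
    by (simp add: distr_distr o_def)
  have IH: "distr M borel (\<lambda>\<omega>. \<Sum>i\<in>I. a i *\<^sub>R G i \<omega>) = gauss (\<Sum>i\<in>I. (a i)\<^sup>2)" if "(\<Sum>i\<in>I. (a i)\<^sup>2) > 0"
    using insert.prems that by (intro insert.IH indep_vars_subset[of _ _ "insert i I" I]) auto
  show ?case
  \<comment> \<open>If one of the two parts has variance 0, the convolution formula does not apply,
    as \<open>gauss 0\<close> is not a point mass; that part vanishes and the other one is the whole
    sum.\<close>
  proof (cases "a i = 0 \<or> (\<Sum>i\<in>I. (a i)\<^sup>2) = 0")
    case True
    then show ?thesis
    proof
      assume "a i = 0"
      then show ?thesis using insert IH by simp
    next
      assume 0: "(\<Sum>i\<in>I. (a i)\<^sup>2) = 0"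
      then have "\<forall>j\<in>I. a j = 0" using insert.hyps by (simp add: sum_nonneg_eq_0_iff)
      then show ?thesis using insert.hyps insert.prems 0 Gi by simp
    qed
  next
    case False
    then have pos: "(\<Sum>i\<in>I. (a i)\<^sup>2) > 0" "(a i)\<^sup>2 > 0"
      by (auto simp: less_le intro!: sum_nonneg)
    have ind: "indep_vars (\<lambda>_. borel) (\<lambda>j \<omega>. a j *\<^sub>R G j \<omega>) (insert i I)"
      by (rule indep_vars_compose2[OF insert.prems(1)]) simp
    show ?thesis
    proof (rule measure_eqI)
      fix A :: "'b set" assume "A \<in> sets (distr M borel (\<lambda>\<omega>. \<Sum>i\<in>insert i I. a i *\<^sub>R G i \<omega>))"
      then have [measurable]: "A \<in> sets borel" by simp
      have "emeasure (distr M borel (\<lambda>\<omega>. \<Sum>i\<in>insert i I. a i *\<^sub>R G i \<omega>)) A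
          = (\<integral>\<^sup>+x. indicator A x \<partial>distr M borel (\<lambda>\<omega>. \<Sum>i\<in>insert i I. a i *\<^sub>R G i \<omega>))"
        by simp
      also have "\<dots> = (\<integral>\<^sup>+\<omega>. indicator A (a i *\<^sub>R G i \<omega> + (\<Sum>i\<in>I. a i *\<^sub>R G i \<omega>)) \<partial>M)"
        using insert.hyps by (subst nn_integral_distr) auto
      also have "\<dots> = (\<integral>\<^sup>+\<omega>. (\<integral>\<^sup>+\<omega>'. indicator A (a i *\<^sub>R G i \<omega> + (\<Sum>i\<in>I. a i *\<^sub>R G i \<omega>')) \<partial>M) \<partial>M)"
        by (rule nn_integral_indep_var_add[OF indep_vars_sum_euclidean[OF insert.hyps ind]]) simp
      also have "\<dots> = (\<integral>\<^sup>+y. (\<integral>\<^sup>+x. indicator A (x + y) \<partial>distr M borel (\<lambda>\<omega>. \<Sum>i\<in>I. a i *\<^sub>R G i \<omega>)) \<partial>distr M borel (\<lambda>\<omega>. a i *\<^sub>R G i \<omega>))"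
      proof -
        interpret S: prob_space "distr M borel (\<lambda>\<omega>. \<Sum>i\<in>I. a i *\<^sub>R G i \<omega>)" by (rule prob_space_distr) simp
        show ?thesis
          by (subst nn_integral_distr, simp, measurable) (simp add: nn_integral_distr add.commute)
      qed
      also have "\<dots> = (\<integral>\<^sup>+z. indicator A z \<partial>gauss ((\<Sum>i\<in>I. (a i)\<^sup>2) + (a i)\<^sup>2))"
      proof -
        have "a i \<noteq> 0" using False by simp
        show ?thesis
          unfolding IH[OF pos(1)] Gi[OF \<open>a i \<noteq> 0\<close>] by (rule nn_integral_gauss_convolution[OF _ pos]) simp
      qed
      finally show "emeasure (distr M borel (\<lambda>\<omega>. \<Sum>i\<in>insert i I. a i *\<^sub>R G i \<omega>)) A = emeasure (gauss (\<Sum>i\<in>insert i I. (a i)\<^sup>2)) A"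
        using insert.hyps by (simp add: add.commute)
    qed simp
  qed
qed simp

subsection \<open>Tails of log-concave densities\<close>

text \<open>\<open>l\<close> is the hazard rate \<open>q t / Q t\<close>, with \<open>Q\<close> the
  tail. Log-concavity makes the hazard rate nondecreasing on the half-line, so
  \<open>Q z * exp (l * z)\<close> rises up to \<open>t\<close> and falls afterwards, and its
  maximum at \<open>t\<close> is the claimed bound.\<close>

lemma log_concave_density_tail_bound:
  fixes q :: "real \<Rightarrow> real"
  defines "\<mu> \<equiv> density lborel (\<lambda>w. ennreal (q w) * indicator {0..} w)"
  assumes prob: "prob_space \<mu>"
    and cont: "continuous_on UNIV q" and nonneg: "\<And>w. q w \<ge> 0" and pos: "\<And>w. w > 0 \<Longrightarrow> q w > 0"
    and log_concave: "\<And>x y h. 0 \<le> x \<Longrightarrow> x \<le> y \<Longrightarrow> 0 \<le> h \<Longrightarrow> q x * q (y + h) \<le> q y * q (x + h)"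
    and t: "t > 0"
  obtains l where "l > 0" "\<And>z. measure \<mu> {z<..} \<le> measure \<mu> {t<..} * exp (- l * (z - t))"
proof -
  interpret \<mu>: prob_space \<mu> by fact
  have [measurable]: "q \<in> borel_measurable borel" using cont by (rule borel_measurable_continuous_onI)
  have sets\<mu>[simp, measurable_cong]: "sets \<mu> = sets borel" by (simp add: \<mu>_def)
  have space\<mu>[simp]: "space \<mu> = UNIV" by (simp add: \<mu>_def)
  define Q where "Q = (\<lambda>z. measure \<mu> {z<..})"
  define F where "F = (\<lambda>z. integral {0..z} q)"
  have contI: "continuous_on {a..b} q" for a b using cont by (rule continuous_on_subset) simp
  have Q_F: "Q z = 1 - F z" if "z \<ge> 0" for z
  proof -
    have "emeasure \<mu> {..z} = (\<integral>\<^sup>+w. ennreal (q w) * indicator {0..z} w \<partial>lborel)"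
      unfolding \<mu>_def by (subst emeasure_density) (auto intro!: nn_integral_cong simp: indicator_def)
    also have "\<dots> = ennreal (F z)"
      unfolding F_def using nonneg
      by (intro nn_integral_has_integral_lebesgue') (auto intro!: integrable_integral integrable_continuous_real contI)
    finally have "measure \<mu> {..z} = F z"
      using nonneg by (simp add: measure_def F_def integral_nonneg integrable_continuous_real contI)
    moreover have "{z<..} = space \<mu> - {..z}" by auto
    ultimately show ?thesis unfolding Q_def by (simp only:) (subst \<mu>.prob_compl, auto)
  qed
  have dF: "(F has_real_derivative q z) (at z)" if "z > 0" for z
  proof -
    have "(F has_real_derivative q z) (at z within {0..z + 1})"
      unfolding F_def using that by (intro integral_has_real_derivative contI) auto
    then show ?thesis using that by (subst (asm) at_within_interior) (auto simp: interior_atLeastAtMost_real)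
  qed
  have contF: "continuous_on {0..b} F" for b
    unfolding F_def by (intro indefinite_integral_continuous_1 integrable_continuous_real contI)
  have F0: "F 0 = 0" by (simp add: F_def)
  have Qpos: "Q z > 0" if "z > 0" for z
  proof -
    have "F z < F (z + 1)"
    proof (rule DERIV_pos_imp_increasing[of z "z + 1" F])
      show "\<exists>y. (F has_real_derivative y) (at x) \<and> 0 < y" if "z \<le> x" "x \<le> z + 1" for x
        using that \<open>z > 0\<close> by (intro exI[of _ "q x"] conjI dF pos) auto
    qed simp
    moreover have "Q (z + 1) \<ge> 0" by (simp add: Q_def)
    ultimately show ?thesis using that by (simp add: Q_F)
  qed
  have tail: "ennreal (Q z) = (\<integral>\<^sup>+h. ennreal (q (z + h)) * indicator {0<..} h \<partial>lborel)" if "z \<ge> 0" for z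
  proof -
    have "ennreal (Q z) = emeasure \<mu> {z<..}" by (simp add: Q_def \<mu>.emeasure_eq_measure)
    also have "\<dots> = (\<integral>\<^sup>+w. ennreal (q w) * indicator {z<..} w \<partial>lborel)"
      unfolding \<mu>_def using that by (subst emeasure_density) (auto intro!: nn_integral_cong simp: indicator_def)
    also have "\<dots> = (\<integral>\<^sup>+h. ennreal (q (z + h)) * indicator {z<..} (z + h) \<partial>lborel)"
      by (rule nn_integral_lborel_translate[symmetric]) simp
    finally show ?thesis by (simp add: indicator_def)
  qed
  \<comment> \<open>Monotonicity of the hazard rate \<open>q / Q\<close> without division: the
    log-concavity inequality integrated over \<open>h > 0\<close>.\<close>
  have hazard: "q x * Q y \<le> q y * Q x" if "0 \<le> x" "x \<le> y" for x y
  proof -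
    have "ennreal (q x * Q y) = (\<integral>\<^sup>+h. ennreal (q x * q (y + h)) * indicator {0<..} h \<partial>lborel)"
      using that nonneg by (simp add: ennreal_mult Q_def tail[of y, unfolded Q_def] mult.assoc nn_integral_cmult)
    also have "\<dots> \<le> (\<integral>\<^sup>+h. ennreal (q y * q (x + h)) * indicator {0<..} h \<partial>lborel)"
      using that by (intro nn_integral_mono) (auto simp: indicator_def intro!: ennreal_leI log_concave)
    also have "\<dots> = ennreal (q y * Q x)"
      using that nonneg by (simp add: ennreal_mult Q_def tail[of x, unfolded Q_def] mult.assoc nn_integral_cmult)
    finally show ?thesis
      using nonneg by (subst (asm) ennreal_le_iff) (auto simp: Q_def)
  qed
  define l where "l = q t / Q t"
  have l: "l > 0" using pos[OF t] Qpos[OF t] by (simp add: l_def)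
  \<comment> \<open>For \<open>z > 0\<close> the derivative of \<phi> has the sign of
    \<open>l * Q z - q z\<close>, which \<open>hazard\<close> decides on either side of
    \<open>t\<close>.\<close>
  define \<phi> where "\<phi> = (\<lambda>z. (1 - F z) * exp (l * z))"
  have d\<phi>: "(\<phi> has_real_derivative (l * Q z - q z) * exp (l * z)) (at z)" if "z > 0" for z
    unfolding \<phi>_def by (rule derivative_eq_intros dF that refl)+ (use that in \<open>simp add: Q_F algebra_simps\<close>)
  have cont\<phi>: "continuous_on {0..b} \<phi>" for b
    unfolding \<phi>_def by (intro continuous_intros contF)
  have \<phi>_le: "\<phi> z \<le> \<phi> t" if "z \<ge> 0" for z
  proof (cases "z \<le> t")
    case True
    have "\<exists>y. (\<phi> has_real_derivative y) (at x) \<and> y \<ge> 0" if "z < x" "x < t" for x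
    proof (intro exI conjI)
      show "(\<phi> has_real_derivative (l * Q x - q x) * exp (l * x)) (at x)"
        using that \<open>z \<ge> 0\<close> by (intro d\<phi>) simp
      show "0 \<le> (l * Q x - q x) * exp (l * x)"
        using hazard[of x t] that \<open>z \<ge> 0\<close> Qpos[OF t] by (intro mult_nonneg_nonneg) (auto simp: l_def field_simps)
    qed
    moreover have "continuous_on {z..t} \<phi>"
      using that by (intro continuous_on_subset[OF cont\<phi>[of t]]) auto
    ultimately show ?thesis by (intro DERIV_nonneg_imp_increasing_open[OF True]) auto
  next
    case False
    have "\<exists>y. (\<phi> has_real_derivative y) (at x) \<and> y \<le> 0" if "t \<le> x" for x
    proof (intro exI conjI)
      show "(\<phi> has_real_derivative (l * Q x - q x) * exp (l * x)) (at x)"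
        using that t by (intro d\<phi>) simp
      show "(l * Q x - q x) * exp (l * x) \<le> 0"
        using hazard[of t x] that t Qpos[OF t] by (intro mult_nonpos_nonneg) (auto simp: l_def field_simps)
    qed
    then show ?thesis using False by (intro DERIV_nonpos_imp_nonincreasing[of t z]) auto
  qed
  have bound: "Q z \<le> Q t * exp (- l * (z - t))" if "z \<ge> 0" for z
  proof -
    have "Q z * exp (l * z) \<le> Q t * exp (l * t)"
      using \<phi>_le[OF that] that t by (simp add: \<phi>_def Q_F)
    then have "Q z \<le> Q t * exp (l * t) / exp (l * z)" by (simp add: field_simps)
    then show ?thesis by (simp add: algebra_simps exp_diff)
  qed
  show thesis
  proof (rule that[OF l])
    show "measure \<mu> {z<..} \<le> measure \<mu> {t<..} * exp (- l * (z - t))" for z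
    proof (cases "z \<ge> 0")
      case False
      \<comment> \<open>For negative \<open>z\<close> the bound at 0 suffices: there
        \<open>Q\<close> equals 1, and the right side only grows as \<open>z\<close>
        decreases.\<close>
      have "Q z \<le> 1" by (simp add: Q_def)
      also have "\<dots> \<le> Q t * exp (- l * (0 - t))" using bound[of 0] by (simp add: Q_F F0)
      also have "\<dots> \<le> Q t * exp (- l * (z - t))"
        using mult_pos_neg[OF l, of z] False
        by (intro mult_left_mono) (auto simp: Q_def right_diff_distrib)
      finally show ?thesis by (simp add: Q_def)
    qed (use bound in \<open>simp add: Q_def\<close>)
  qed
qed

text \<open>The squared norm has a density proportional to
  \<open>w powr (d / 2 - 1) * exp (- w / (2 * v))\<close> on the half-line, with \<open>d\<close>
  the dimension; it is log-concave exactly because \<open>d \<ge> 2\<close> makes the exponent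
  nonnegative.\<close>

lemma gauss_norm_power2_tail_bound:
  fixes v t :: real
  defines "Q \<equiv> \<lambda>z. measure (gauss v :: 'a::euclidean_space measure) {x. (norm x)\<^sup>2 > z}"
  assumes dim: "DIM('a) \<ge> 2" and v: "v > 0" and t: "t > 0"
  obtains l where "l > 0" "\<And>z. Q z \<le> Q t * exp (- l * (z - t))"
proof -
  define C where "C = measure lborel (cone_of (UNIV :: 'a set)) * (DIM('a) / 2) * (2 * pi * v) powr (- real DIM('a) / 2)"
  \<comment> \<open>A natural power of a square root keeps \<open>q\<close> continuous at 0 also in
    dimension two, where \<open>0 powr 0 = 0\<close> would break continuity; the absolute value
    keeps \<open>q\<close> nonnegative on the negative half-line.\<close>
  define q where "q = (\<lambda>w. C * (sqrt \<bar>w\<bar> ^ (DIM('a) - 2) * exp (- w / (2 * v))))"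
  define \<mu> where "\<mu> = density lborel (\<lambda>w. ennreal (q w) * indicator {0..} w)"
  have cone: "emeasure lborel (cone_of (UNIV :: 'a set)) = ennreal (measure lborel (cone_of (UNIV :: 'a set)))"
    using emeasure_cone_of_finite[of "UNIV :: 'a set"] by (intro emeasure_eq_ennreal_measure) auto
  have [measurable]: "q \<in> borel_measurable borel" unfolding q_def by measurable
  have C0: "C \<ge> 0" by (simp add: C_def)
  have "sqrt \<bar>w\<bar> ^ (DIM('a) - 2) = w powr (DIM('a) / 2 - 1)" if "w > 0" for w
  proof -
    have "sqrt w ^ (DIM('a) - 2) = w powr (real (DIM('a) - 2) / 2)"
      using that by (simp add: powr_half_sqrt[symmetric] powr_powr flip: powr_realpow)
    also have "real (DIM('a) - 2) / 2 = DIM('a) / 2 - 1"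
      using dim by (simp add: of_nat_diff diff_divide_distrib)
    finally show ?thesis using that by simp
  qed
  then have q_eq: "q w = measure lborel (cone_of (UNIV :: 'a set)) * (DIM('a) / 2 * w powr (DIM('a) / 2 - 1) *
     ((2 * pi * v) powr (- real DIM('a) / 2) * exp (- w / (2 * v))))" if "w > 0" for w
    using that by (simp add: q_def C_def)
  have q_mult: "q a * q b = C * C * exp (- (a + b) / (2 * v)) * (sqrt a * sqrt b) ^ (DIM('a) - 2)"
    if "a \<ge> 0" "b \<ge> 0" for a b
  proof -
    have "- (a + b) / (2 * v) = - a / (2 * v) + - b / (2 * v)" by (simp add: add_divide_distrib diff_divide_distrib)
    then have "exp (- (a + b) / (2 * v)) = exp (- a / (2 * v)) * exp (- b / (2 * v))" by (simp only: exp_add)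
    then show ?thesis using that by (simp only: q_def power_mult_distrib) (simp add: mult_ac)
  qed
  have law: "distr (gauss v) borel (\<lambda>x::'a. (norm x)\<^sup>2) = \<mu>"
  proof (rule measure_eqI)
    fix A assume "A \<in> sets (distr (gauss v) borel (\<lambda>x::'a. (norm x)\<^sup>2))"
    then have [measurable]: "A \<in> sets borel" by simp
    define h where "h = (\<lambda>w. ennreal ((2 * pi * v) powr (- real DIM('a) / 2) * exp (- w / (2 * v))) * indicator A w)"
    have [measurable]: "h \<in> borel_measurable borel" unfolding h_def by measurable
    have "emeasure (distr (gauss v) borel (\<lambda>x::'a. (norm x)\<^sup>2)) A = (\<integral>\<^sup>+w. indicator A w \<partial>distr (gauss v) borel (\<lambda>x::'a. (norm x)\<^sup>2))"
      by simp
    also have "\<dots> = (\<integral>\<^sup>+x. indicator UNIV (sgn x) * h ((norm x)\<^sup>2) \<partial>(lborel :: 'a measure))"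
      by (subst nn_integral_distr, measurable) (simp add: nn_integral_gauss gauss_density_def h_def)
    also have "\<dots> = emeasure lborel (cone_of (UNIV :: 'a set)) *
      (\<integral>\<^sup>+w. ennreal (DIM('a) / 2 * w powr (DIM('a) / 2 - 1)) * indicator {0<..} w * h w \<partial>lborel)"
      by (rule nn_integral_polar) auto
    also have "\<dots> = (\<integral>\<^sup>+w. ennreal (measure lborel (cone_of (UNIV :: 'a set))) *
         (ennreal (DIM('a) / 2 * w powr (DIM('a) / 2 - 1)) * indicator {0<..} w * h w) \<partial>lborel)"
      unfolding cone by (rule nn_integral_cmult[symmetric]) simp
    also have "\<dots> = (\<integral>\<^sup>+w. ennreal (q w) * indicator {0..} w * indicator A w \<partial>lborel)"
      using AE_lborel_singleton[of "0::real"]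
      by (intro nn_integral_cong_AE) (auto elim!: eventually_mono simp: indicator_def h_def q_eq simp flip: ennreal_mult')
    also have "\<dots> = emeasure \<mu> A"
      by (simp add: \<mu>_def emeasure_density)
    finally show "emeasure (distr (gauss v) borel (\<lambda>x::'a. (norm x)\<^sup>2)) A = emeasure \<mu> A" .
  qed (simp add: \<mu>_def)
  interpret \<gamma>: prob_space "gauss v :: 'a measure" using v by (rule prob_space_gauss)
  have prob: "prob_space \<mu>"
    unfolding law[symmetric] by (rule \<gamma>.prob_space_distr) simp
  \<comment> \<open>Positivity of the constant follows from the total mass being 1, without
    computing the volume of the ball.\<close>
  have "C \<noteq> 0"
  proof
    assume "C = 0"
    then have "emeasure \<mu> (space \<mu>) = 0" by (simp add: \<mu>_def q_def emeasure_density)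
    then show False using prob_space.emeasure_space_1[OF prob] by simp
  qed
  with C0 have C: "C > 0" by simp
  have Q: "Q z = measure \<mu> {z<..}" for z
    unfolding Q_def law[symmetric] by (subst measure_distr) (auto simp: vimage_def)
  obtain l where l: "l > 0" "\<And>z. measure \<mu> {z<..} \<le> measure \<mu> {t<..} * exp (- l * (z - t))"
    unfolding \<mu>_def
  proof (rule log_concave_density_tail_bound[of q t])
    show "prob_space (density lborel (\<lambda>w. ennreal (q w) * indicator {0..} w))" using prob by (simp add: \<mu>_def)
    show "continuous_on UNIV q" unfolding q_def using v by (intro continuous_intros) auto
    show "q w \<ge> 0" for w using C by (simp add: q_def)
    show "q w > 0" if "w > 0" for w using C that by (simp add: q_def)
    show "q x * q (y + h) \<le> q y * q (x + h)" if h: "0 \<le> x" "x \<le> y" "0 \<le> h" for x y h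
    proof -
      \<comment> \<open>Both products carry the same exponential factor by \<open>q_mult\<close>, so
        what remains is \<open>x * (y + h) \<le> y * (x + h)\<close>, that is,
        \<open>x * h \<le> y * h\<close>.\<close>
      have "sqrt x * sqrt (y + h) \<le> sqrt y * sqrt (x + h)"
        using h mult_right_mono[of x y h] by (simp add: algebra_simps flip: real_sqrt_mult)
      then have "(sqrt x * sqrt (y + h)) ^ (DIM('a) - 2) \<le> (sqrt y * sqrt (x + h)) ^ (DIM('a) - 2)"
        using h by (intro power_mono) auto
      then have "(C * C * exp (- (x + (y + h)) / (2 * v))) * (sqrt x * sqrt (y + h)) ^ (DIM('a) - 2) \<le>
         (C * C * exp (- (y + (x + h)) / (2 * v))) * (sqrt y * sqrt (x + h)) ^ (DIM('a) - 2)"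
        using C by (subst add.left_commute[of x y h]) (intro mult_left_mono, auto)
      then show ?thesis
        using h by (simp add: q_mult)
    qed
  qed (use t in auto)
  show thesis by (rule that[OF l(1)]) (use l(2) in \<open>simp add: Q\<close>)
qed

text \<open>Layer-cake formula: the cube is the integral of \<open>3 * (z - s)\<^sup>2\<close> over
  \<open>z\<close> from \<open>s\<close> to the value of \<open>Z\<close>. Exchanging integrals
  replaces the indicator of \<open>Z > z\<close> by its probability, and the exponential bound
  leaves a Gamma integral.\<close>

lemma (in prob_space) nn_integral_excess_cube_le:
  fixes Z :: "'a \<Rightarrow> real"
  assumes Z[measurable]: "Z \<in> borel_measurable M" and l: "l > 0" and B: "B \<ge> 0"
    and tail: "\<And>z. measure M {\<omega> \<in> space M. Z \<omega> > z} \<le> B * exp (- l * (z - t))"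
  shows "(\<integral>\<^sup>+\<omega>. ennreal (max 0 (Z \<omega> - s) ^ 3) \<partial>M) \<le> ennreal (B * exp (l * (t - s)) * 6 / l ^ 3)"
proof -
  have cube: "ennreal (max 0 (w - s) ^ 3) = (\<integral>\<^sup>+z. ennreal (3 * (z - s)\<^sup>2) * indicator {s<..} z * indicator {z<..} w \<partial>lborel)" for w
  proof (cases "w > s")
    case True
    have "((\<lambda>z. 3 * (z - s)\<^sup>2) has_integral ((w - s) ^ 3 - (s - s) ^ 3)) {s..w}"
      using True by (intro fundamental_theorem_of_calculus)
       (auto intro!: derivative_eq_intros simp flip: has_real_derivative_iff_has_vector_derivative)
    then have "(\<integral>\<^sup>+z. ennreal (3 * (z - s)\<^sup>2) * indicator {s..w} z \<partial>lborel) = ennreal ((w - s) ^ 3)"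
      by (intro nn_integral_has_integral_lebesgue') auto
    moreover have "(\<integral>\<^sup>+z. ennreal (3 * (z - s)\<^sup>2) * indicator {s..w} z \<partial>lborel) =
      (\<integral>\<^sup>+z. ennreal (3 * (z - s)\<^sup>2) * indicator {s<..} z * indicator {z<..} w \<partial>lborel)"
    proof (rule nn_integral_cong_AE)
      show "AE z in lborel. ennreal (3 * (z - s)\<^sup>2) * indicator {s..w} z =
          ennreal (3 * (z - s)\<^sup>2) * indicator {s<..} z * indicator {z<..} w"
        using AE_lborel_singleton[of s] AE_lborel_singleton[of w]
        by eventually_elim (auto simp: indicator_def)
    qed
    ultimately show ?thesis using True by simp
  next
    case False
    then have "(\<lambda>z. ennreal (3 * (z - s)\<^sup>2) * indicator {s<..} z * indicator {z<..} w) = (\<lambda>_. 0)"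
      by (auto simp: fun_eq_iff indicator_def)
    then show ?thesis using False by simp
  qed
  interpret P: pair_sigma_finite M "lborel :: real measure" ..
  have "(\<integral>\<^sup>+\<omega>. ennreal (max 0 (Z \<omega> - s) ^ 3) \<partial>M) =
    (\<integral>\<^sup>+\<omega>. (\<integral>\<^sup>+z. ennreal (3 * (z - s)\<^sup>2) * indicator {s<..} z * indicator {z<..} (Z \<omega>) \<partial>lborel) \<partial>M)"
    by (simp only: cube)
  also have "\<dots> = (\<integral>\<^sup>+z. (\<integral>\<^sup>+\<omega>. ennreal (3 * (z - s)\<^sup>2) * indicator {s<..} z * indicator {z<..} (Z \<omega>) \<partial>M) \<partial>lborel)"
    by (rule P.Fubini'[symmetric]) (simp add: greaterThan_def)
  also have "\<dots> \<le> (\<integral>\<^sup>+z. ennreal (3 * (z - s)\<^sup>2) * indicator {s<..} z * ennreal (B * exp (- l * (z - t))) \<partial>lborel)"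
  proof (rule nn_integral_mono)
    fix z
    have "(\<integral>\<^sup>+\<omega>. indicator {z<..} (Z \<omega>) \<partial>M) = (\<integral>\<^sup>+\<omega>. indicator {\<omega> \<in> space M. Z \<omega> > z} \<omega> \<partial>M)"
      by (intro nn_integral_cong) (auto simp: indicator_def)
    also have "\<dots> = ennreal (measure M {\<omega> \<in> space M. Z \<omega> > z})"
      by (simp add: emeasure_eq_measure)
    also have "\<dots> \<le> ennreal (B * exp (- l * (z - t)))" by (intro ennreal_leI tail)
    finally show "(\<integral>\<^sup>+\<omega>. ennreal (3 * (z - s)\<^sup>2) * indicator {s<..} z * indicator {z<..} (Z \<omega>) \<partial>M) \<le>
      ennreal (3 * (z - s)\<^sup>2) * indicator {s<..} z * ennreal (B * exp (- l * (z - t)))"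
      by (subst nn_integral_cmult) (auto intro!: mult_left_mono)
  qed
  \<comment> \<open>Written in terms of \<open>l * (z - s)\<close>, in preparation for the
    substitution that leads to the integral of \<open>x\<^sup>2 * exp (- x)\<close> over the
    half-line, which is 2.\<close>
  also have "\<dots> = (\<integral>\<^sup>+z. ennreal (3 * B * exp (l * (t - s)) / l\<^sup>2) * (ennreal ((l * (z - s)) ^ 2 * exp (- (l * (z - s)))) * indicator {0..} (l * (z - s))) \<partial>lborel)"
  proof -
    have e: "exp (- (l * (z - t))) = exp (l * (t - s)) * exp (- (l * (z - s)))" for z
      by (simp add: mult_exp_exp algebra_simps)
    show ?thesis
      using AE_lborel_singleton[of s] l B
      by (intro nn_integral_cong_AE)
         (auto elim!: eventually_mono simp: indicator_def e zero_le_mult_iff power_mult_distrib mult_ac simp flip: ennreal_mult')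
  qed
  also have "\<dots> = ennreal (3 * B * exp (l * (t - s)) / l\<^sup>2) * (\<integral>\<^sup>+z. ennreal ((l * (z - s)) ^ 2 * exp (- (l * (z - s)))) * indicator {0..} (l * (z - s)) \<partial>lborel)"
    by (rule nn_integral_cmult) measurable
  also have "(\<integral>\<^sup>+z. ennreal ((l * (z - s)) ^ 2 * exp (- (l * (z - s)))) * indicator {0..} (l * (z - s)) \<partial>lborel) = ennreal (2 / l)"
  proof -
    have "- (l * s) + l * z = l * (z - s)" for z by (simp add: algebra_simps)
    then have "(\<integral>\<^sup>+x. ennreal (x ^ 2 * exp (- x)) * indicator {0..} x \<partial>lborel) =
       \<bar>l\<bar> * (\<integral>\<^sup>+z. ennreal ((l * (z - s)) ^ 2 * exp (- (l * (z - s)))) * indicator {0..} (l * (z - s)) \<partial>lborel)"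
      using l nn_integral_real_affine[of "\<lambda>x. ennreal (x ^ 2 * exp (- x)) * indicator {0..} x" l "- (l * s)"] by simp
    then have "ennreal 2 = ennreal l * (\<integral>\<^sup>+z. ennreal ((l * (z - s)) ^ 2 * exp (- (l * (z - s)))) * indicator {0..} (l * (z - s)) \<partial>lborel)"
      using l nn_intergal_power_times_exp_Ici[of 2] by (simp add: fact_numeral)
    then have "ennreal (1 / l) * ennreal 2 = ennreal (1 / l) * ennreal l * (\<integral>\<^sup>+z. ennreal ((l * (z - s)) ^ 2 * exp (- (l * (z - s)))) * indicator {0..} (l * (z - s)) \<partial>lborel)"
      by (simp add: mult.assoc)
    moreover have "ennreal (1 / l) * ennreal 2 = ennreal (2 / l)" "ennreal (1 / l) * ennreal l = 1"
      using l by (simp_all flip: ennreal_mult' del: ennreal_numeral)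
    ultimately show ?thesis by (simp only: mult_1)
  qed
  also have "ennreal (3 * B * exp (l * (t - s)) / l\<^sup>2) * ennreal (2 / l) = ennreal (B * exp (l * (t - s)) * 6 / l ^ 3)"
    using l B by (simp add: power3_eq_cube power2_eq_square mult_ac flip: ennreal_mult')
  finally show ?thesis .
qed

subsection \<open>The tail comparison\<close>

lemma distr_std_gaussian_vector:
  assumes "std_gaussian_vector N X"
  shows "distr N borel X = (gauss 1 :: 'a::euclidean_space measure)"
proof -
  have "distr N borel X = distr N lborel X" by (rule distr_cong) auto
  also have "\<dots> = gauss 1"
    using assms distributed_distr_eq_density[of N lborel X]
    by (auto simp: std_gaussian_vector_def gauss_def gauss_density_def)
  finally show ?thesis .
qed

theorem theorem1:
  fixes M :: "'p measure" and N :: "'q measure"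
    and \<xi> :: "nat \<Rightarrow> 'p \<Rightarrow> real ^ 'n" and G :: "nat \<Rightarrow> 'q \<Rightarrow> real ^ 'n"
    and a :: "nat \<Rightarrow> real" and m :: nat and t :: real
  assumes "CARD('n) \<ge> 2"
    and "prob_space M" and "prob_space N"
    and "prob_space.indep_vars M (\<lambda>_. borel) \<xi> {1..}"
    and "\<And>i. i \<ge> 1 \<Longrightarrow> uniform_on_sphere M (\<xi> i)"
    and "prob_space.indep_vars N (\<lambda>_. borel) G {1..}"
    and "\<And>i. i \<ge> 1 \<Longrightarrow> std_gaussian_vector N (G i)"
    and "m \<ge> 1" and "t > 0"
  shows "measure M {\<omega> \<in> space M. norm (\<Sum>i=1..m. a i *\<^sub>R \<xi> i \<omega>) > t}
    \<le> 397 * measure N {\<omega> \<in> space N.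
          norm (\<Sum>i=1..m. a i *\<^sub>R (G i \<omega> /\<^sub>R sqrt (real CARD('n)))) > t}"
proof -
  interpret M: prob_space M by fact
  interpret N: prob_space N by fact
  define b where "b = (\<lambda>i. a i / sqrt (real CARD('n)))"
  define S where "S = (\<lambda>\<omega>. \<Sum>i=1..m. a i *\<^sub>R \<xi> i \<omega>)"
  define T where "T = (\<lambda>\<omega>. \<Sum>i=1..m. b i *\<^sub>R G i \<omega>)"
  define v where "v = (\<Sum>i=1..m. (b i)\<^sup>2)"
  have T_eq: "(\<Sum>i=1..m. a i *\<^sub>R (G i \<omega> /\<^sub>R sqrt (real CARD('n)))) = T \<omega>" for \<omega>
    by (simp add: T_def b_def divide_inverse)
  have rv: "\<xi> i \<in> borel_measurable M" "G i \<in> borel_measurable N" if "i \<ge> 1" for i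
    using assms(4,6) that by (auto simp: M.indep_vars_def N.indep_vars_def)
  have [measurable]: "S \<in> borel_measurable M" "T \<in> borel_measurable N"
    unfolding S_def T_def using rv by (auto intro!: borel_measurable_sum borel_measurable_scaleR)
  have G_law: "distr N borel (G i) = gauss 1" if "i \<ge> 1" for i
    using assms(7) that by (intro distr_std_gaussian_vector) auto
  show ?thesis
  proof (cases "v = 0")
    case True
    \<comment> \<open>In the degenerate case all coefficients vanish, so the left probability is 0
      because \<open>t > 0\<close>.\<close>
    then have "\<forall>i\<in>{1..m}. a i = 0" by (simp add: v_def b_def sum_nonneg_eq_0_iff)
    then have "S \<omega> = 0" for \<omega> by (simp add: S_def)
    then show ?thesis using \<open>t > 0\<close> by (simp add: S_def)
  next
    case False
    then have v: "v > 0" by (simp add: v_def less_le sum_nonneg)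
    have T_law: "distr N borel T = gauss v"
      unfolding T_def v_def using v G_law
      by (intro N.distr_sum_gauss N.indep_vars_subset[OF assms(6)]) (auto simp: v_def)
    define Q where "Q = (\<lambda>z. measure (gauss v :: (real ^ 'n) measure) {x. (norm x)\<^sup>2 > z})"
    have Q_eq: "Q z = measure N {\<omega> \<in> space N. (norm (T \<omega>))\<^sup>2 > z}" for z
      unfolding Q_def T_law[symmetric] by (subst measure_distr) (auto intro!: arg_cong[where f = "measure N"])
    have "DIM(real ^ 'n) \<ge> 2" "t\<^sup>2 > 0" using assms by auto
    from gauss_norm_power2_tail_bound[OF this(1) v this(2)]
    obtain l where l: "l > 0" "\<And>z. Q z \<le> Q (t\<^sup>2) * exp (- l * (z - t\<^sup>2))"
      unfolding Q_def by blast
    \<comment> \<open>With \<open>u = l * (t\<^sup>2 - s)\<close>, Markov's inequality loses the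
      factor \<open>6 * exp u / u ^ 3\<close>, which is smallest at \<open>u = 3\<close>.\<close>
    define s where "s = t\<^sup>2 - 3 / l"
    have norm_gt: "norm x > t \<longleftrightarrow> (norm x)\<^sup>2 > t\<^sup>2" for x :: "real ^ 'n"
      using \<open>t > 0\<close> by (auto simp: power_strict_mono intro: power_less_imp_less_base)
    \<comment> \<open>Markov's inequality: \<open>27 / l ^ 3\<close> is the value of the truncated
      cube at norm \<open>t\<close>, where the excess over \<open>s\<close> is
      \<open>3 / l\<close>.\<close>
    have "ennreal (27 / l ^ 3 * measure M {\<omega> \<in> space M. norm (S \<omega>) > t}) =
       (\<integral>\<^sup>+\<omega>. ennreal (27 / l ^ 3) * indicator {\<omega> \<in> space M. norm (S \<omega>) > t} \<omega> \<partial>M)"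
      using l by (subst nn_integral_cmult) (auto simp: M.emeasure_eq_measure simp flip: ennreal_mult')
    also have "\<dots> \<le> (\<integral>\<^sup>+\<omega>. ennreal (excess_cube s (0 + S \<omega>)) \<partial>M)"
    proof (intro nn_integral_mono)
      fix \<omega>
      have "27 / l ^ 3 \<le> excess_cube s (S \<omega>)" if "norm (S \<omega>) > t"
      proof -
        have "3 / l \<le> max 0 ((norm (S \<omega>))\<^sup>2 - s)" using that by (simp add: s_def norm_gt)
        then have "(3 / l) ^ 3 \<le> excess_cube s (S \<omega>)"
          unfolding excess_cube_def using l by (intro power_mono) auto
        then show ?thesis by (simp add: power_divide)
      qed
      then show "ennreal (27 / l ^ 3) * indicator {\<omega> \<in> space M. norm (S \<omega>) > t} \<omega> \<le> ennreal (excess_cube s (0 + S \<omega>))"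
        by (auto simp: indicator_def intro!: ennreal_leI)
    qed
    also have "\<dots> \<le> (\<integral>\<^sup>+\<omega>. ennreal (excess_cube s (0 + T \<omega>)) \<partial>N)"
      unfolding S_def T_def
    proof (rule nn_integral_indep_sum_le)
      show "M.indep_vars (\<lambda>_. borel) (\<lambda>i \<omega>. a i *\<^sub>R \<xi> i \<omega>) {1..m}"
        by (rule M.indep_vars_compose2[OF M.indep_vars_subset[OF assms(4)]]) auto
      show "N.indep_vars (\<lambda>_. borel) (\<lambda>i \<omega>. b i *\<^sub>R G i \<omega>) {1..m}"
        by (rule N.indep_vars_compose2[OF N.indep_vars_subset[OF assms(6)]]) auto
      fix i x assume "i \<in> {1..m}"
      then have i: "i \<ge> 1" by simp
      note [measurable] = rv[OF i]
      have "(\<integral>\<^sup>+\<omega>. ennreal (excess_cube s (x + a i *\<^sub>R \<xi> i \<omega>)) \<partial>M) = (\<integral>\<^sup>+y. ennreal (excess_cube s (x + a i *\<^sub>R y)) \<partial>distr M borel (\<xi> i))"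
        by (subst nn_integral_distr) auto
      also have "\<dots> \<le> (\<integral>\<^sup>+y. ennreal (excess_cube s (x + b i *\<^sub>R y)) \<partial>gauss 1)"
        using excess_cube_sphere_le_gauss[OF uniform_sphere_law_distr[OF M.prob_space_axioms assms(5)[OF i]]]
        by (simp add: b_def)
      also have "\<dots> = (\<integral>\<^sup>+\<omega>. ennreal (excess_cube s (x + b i *\<^sub>R G i \<omega>)) \<partial>N)"
        unfolding G_law[OF i, symmetric] by (subst nn_integral_distr) auto
      finally show "(\<integral>\<^sup>+\<omega>. ennreal (excess_cube s (x + a i *\<^sub>R \<xi> i \<omega>)) \<partial>M) \<le> (\<integral>\<^sup>+\<omega>. ennreal (excess_cube s (x + b i *\<^sub>R G i \<omega>)) \<partial>N)" .
    qed (use assms in auto)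
    also have "\<dots> \<le> ennreal (Q (t\<^sup>2) * exp (l * (t\<^sup>2 - s)) * 6 / l ^ 3)"
      unfolding excess_cube_def add_0
      by (rule N.nn_integral_excess_cube_le[OF _ l(1)]) (use l(2) Q_eq in \<open>auto simp: Q_def\<close>)
    finally have "27 / l ^ 3 * measure M {\<omega> \<in> space M. norm (S \<omega>) > t} \<le> Q (t\<^sup>2) * exp (l * (t\<^sup>2 - s)) * 6 / l ^ 3"
      using l by (subst (asm) ennreal_le_iff) (auto simp: Q_def)
    moreover have "l * (t\<^sup>2 - s) = 3" using l by (simp add: s_def)
    ultimately have "27 * measure M {\<omega> \<in> space M. norm (S \<omega>) > t} \<le> 6 * exp 3 * Q (t\<^sup>2)"
      using l by (simp add: field_simps)
    \<comment> \<open>The estimate of \<open>exp 1\<close> by 3 cancels the 27 on the left and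
      leaves the constant 6, well below 397.\<close>
    also have "6 * exp 3 * Q (t\<^sup>2) \<le> 6 * 27 * Q (t\<^sup>2)"
    proof -
      have "exp (3::real) = exp 1 ^ 3" by (simp flip: exp_of_nat_mult)
      also have "\<dots> \<le> 3 ^ 3" using exp_le by (intro power_mono) auto
      finally show ?thesis by (intro mult_right_mono) (auto simp: Q_def)
    qed
    finally have "measure M {\<omega> \<in> space M. norm (S \<omega>) > t} \<le> 6 * Q (t\<^sup>2)" by simp
    also have "\<dots> \<le> 397 * Q (t\<^sup>2)" by (simp add: Q_def)
    also have "Q (t\<^sup>2) = measure N {\<omega> \<in> space N. norm (T \<omega>) > t}" by (simp add: Q_eq norm_gt)
    finally show ?thesis by (simp only: T_eq S_def)
  qed
qed

end
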